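(* Let $1\le r\le\infty$, and let $(X,x_0)$ and $(Y,x_0)$ be pointed directed graphs with common basepoint. If $(X,Y)$ is $r$-separable and $X\cap Y$ is connected, then the commutative diagram of groups induced by inclusions $$\begin{array}{ccc} \pi_1^{r}(X\cap Y,x_0)&\to&\pi_1^{r}(X,x_0)\\ \downarrow&&\downarrow\\ \pi_1^{r}(Y,x_0)&\to&\pi_1^{r}(X\cup Y,x_0) \end{array}$$ is a pushout.
   Context: A directed graph $X$ consists of a vertex set $V(X)$ and an edge set $E(X)\subset V(X)\times V(X)-\Delta$, where $\Delta$ is the diagonal. A map $f\colon X\to Y$ is a function $V(X)\to V(Y)$ such that for every $(x,y)\in E(X)$ either $(f(x),f(y))\in E(Y)$ or $f(x)=f(y)$; it is a homomorphism if always $(f(x),f(y))\in E(Y)$. A pointed directed graph is a directed graph with a chosen vertex. Unions and intersections of directed graphs are taken on vertex sets and edge sets. A directed graph is connected if any two vertices are connected by a zig-zag of finitely many edges. For vertices $x,y$, $d(x,y)$ is the minimal length of a directed edge path from $x$ to $y$ ($\infty$ if none), and $L(x_0,\ldots,x_n)=\sum_{i=0}^{n-1}d(x_i,x_{i+1})$. For $1\le r<\infty$, $\mathrm{N}^r(X)$ is the simplicial set whose $n$-simplices are the tuples $(x_0,\ldots,x_n)\in V(X)^{n+1}$ with $L(x_0,\ldots,x_n)\le r$, with faces deleting and degeneracies repeating entries; $\mathrm{N}^\infty(X)$ is defined likewise with $L<\infty$. The $r$-fundamental groupoid $\Pi_1^r(X)$, $1\le r\le\infty$, is the edge-path groupoid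 of $\mathrm{N}^r(X)$: objects are the vertices of $X$, and it is generated by the $1$-simplices $(x,y)$ (as morphisms $x\to y$) subject to $(x,x)=1_x$ and, for each $2$-simplex $(x,y,z)$, that $(x,z)$ equals $(x,y)$ followed by $(y,z)$. The $r$-fundamental group is $\pi_1^r(X,x_0)=\Pi_1^r(X)(x_0,x_0)$. Paths: $\mathcal{I}_0$ consists of the one-vertex graph with vertex $0$; for $n\ge1$, $\mathcal{I}_n$ is the set of directed graphs with vertex set $\{0,\ldots,n\}$ having exactly one of the edges $(i,i+1)$, $(i+1,i)$ for each $0\le i<n$ and no other edges. A path in $X$ is a map $f\colon I_n\to X$ with $I_n\in\mathcal{I}_n$; it is reduced if it is a homomorphism, and is a loop if $f(0)=f(n)$. A subpath of a reduced path $f\colon I\to X$, $I\in\mathcal{I}_n$, is its restriction to the induced subgraph of $I$ on $\{k,\ldots,l\}$ for some $0\le k\le l\le n$. A subgraph is represented by a path if it is the image of that path. For a subgraph $A$ of $X$, the complement $X-A$ is the smallest subgraph of $X$ with $X=(X-A)\cup A$; explicitly $E(X-A)=E(X)-E(A)$, and $V(X-A)$ is $V(X)-V(A)$ together with all endpoints of edges in $E(X-A)$. Subdivision: let $L$ be a subgraph of $X$ represented by a reduced loop. A subdivision of $L$ consists of two subgraphs $L_1,L_2$ of $X$ represented by reduced loops such that $L_1\cap L_2$ is represented by subpaths of $L_1$, $L_2$ and $L=L_1\cup L_2-L_1\cap L_2$. Subdividing iteratively, the resulting subgraphs $L_1,\ldots,L_n$ represented by reduced loops are also called a subdivision of $L$.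 $\Gamma_1$ is the directed graph with vertices $u_0=v_0$, $u_1=v_1$ and edge $(u_0,u_1)$. For $r\ge2$, $\Gamma_r$ has vertices $u_0=v_0,u_1,v_1,\ldots,u_{r-1},v_{r-1},u_r=v_r$ and edges $(u_i,u_{i+1}),(v_i,v_{i+1})$ for $0\le i\le r-1$. A degenerate $\Gamma_r$ in $X$ is the image of a map $\Gamma_r\to X$. Separability: for $1\le r<\infty$, a pair $(X,Y)$ of directed graphs is $r$-separable if any degenerate $\Gamma_r$ in $X\cup Y$ is subdivided into degenerate $\Gamma_r$'s, each of which is in either $X$ or $Y$ (no subdivision is needed if it already lies in $X$ or $Y$). The pair is $\infty$-separable if for any $1\le r<\infty$, any degenerate $\Gamma_r$ in $X\cup Y$ is subdivided into degenerate $\Gamma_s$'s for some $s\ge r$, possibly depending on the given degenerate $\Gamma_r$, each of which is in either $X$ or $Y$. *)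

theory Defs
  imports
    "Graph_Theory.Digraph_Component"
    "HOL-Algebra.Group"
    "HOL-Library.Extended_Nat"
begin

section \<open>Directed graphs\<close>

text \<open>
  Directed graphs are records of type \<open>'a pair_pre_digraph\<close> satisfying
  \<open>pair_loopfree_digraph\<close>; they may be infinite.
\<close>

definition graph_union :: "'a pair_pre_digraph \<Rightarrow> 'a pair_pre_digraph \<Rightarrow> 'a pair_pre_digraph" where
  "graph_union X Y = \<lparr> pverts = pverts X \<union> pverts Y, parcs = parcs X \<union> parcs Y \<rparr>"

definition graph_inter :: "'a pair_pre_digraph \<Rightarrow> 'a pair_pre_digraph \<Rightarrow> 'a pair_pre_digraph" where
  "graph_inter X Y = \<lparr> pverts = pverts X \<inter> pverts Y, parcs = parcs X \<inter> parcs Y \<rparr>"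

definition graph_minus :: "'a pair_pre_digraph \<Rightarrow> 'a pair_pre_digraph \<Rightarrow> 'a pair_pre_digraph" where
  "graph_minus X A =
     \<lparr> pverts = (pverts X - pverts A) \<union> fst ` (parcs X - parcs A) \<union> snd ` (parcs X - parcs A),
       parcs = parcs X - parcs A \<rparr>"

definition induced_on :: "'a pair_pre_digraph \<Rightarrow> 'a set \<Rightarrow> 'a pair_pre_digraph" where
  "induced_on X S = \<lparr> pverts = pverts X \<inter> S, parcs = parcs X \<inter> S \<times> S \<rparr>"

definition is_subgraph :: "'a pair_pre_digraph \<Rightarrow> 'a pair_pre_digraph \<Rightarrow> bool" where
  "is_subgraph A X \<longleftrightarrow> subgraph (with_proj A) (with_proj X)"

definition graph_map :: "'a pair_pre_digraph \<Rightarrow> 'b pair_pre_digraph \<Rightarrow> ('a \<Rightarrow> 'b) \<Rightarrow> bool" where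
  "graph_map X Y f \<longleftrightarrow>
     (\<forall>x \<in> pverts X. f x \<in> pverts Y) \<and>
     (\<forall>(x, y) \<in> parcs X. (f x, f y) \<in> parcs Y \<or> f x = f y)"

definition graph_hom :: "'a pair_pre_digraph \<Rightarrow> 'b pair_pre_digraph \<Rightarrow> ('a \<Rightarrow> 'b) \<Rightarrow> bool" where
  "graph_hom X Y f \<longleftrightarrow>
     graph_map X Y f \<and> (\<forall>(x, y) \<in> parcs X. (f x, f y) \<in> parcs Y)"

text \<open>Edges that a map collapses to a vertex contribute no edge to its image.\<close>

definition graph_image :: "('a \<Rightarrow> 'b) \<Rightarrow> 'a pair_pre_digraph \<Rightarrow> 'b pair_pre_digraph" where
  "graph_image f X =
     \<lparr> pverts = f ` pverts X, parcs = {(f x, f y) | x y. (x, y) \<in> parcs X \<and> f x \<noteq> f y} \<rparr>"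


section \<open>The simplicial sets \<open>N\<^sup>r(X)\<close>\<close>

definition path_dist :: "'a pair_pre_digraph \<Rightarrow> 'a \<Rightarrow> 'a \<Rightarrow> enat" where
  "path_dist X x y = (INF p \<in> {p. pre_digraph.awalk (with_proj X) x p y}. enat (length p))"

definition tuple_length :: "'a pair_pre_digraph \<Rightarrow> 'a list \<Rightarrow> enat" where
  "tuple_length X xs = (\<Sum>i < length xs - 1. path_dist X (xs ! i) (xs ! Suc i))"

text \<open>
  \<open>nerve r X n\<close> is the set of \<open>n\<close>-simplices. At \<open>r = \<infinity>\<close> the bound is strict,
  since every tuple satisfies \<open>L \<le> \<infinity>\<close>.
\<close>

definition nerve :: "enat \<Rightarrow> 'a pair_pre_digraph \<Rightarrow> nat \<Rightarrow> 'a list set" where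
  "nerve r X n =
     {xs. length xs = Suc n \<and> set xs \<subseteq> pverts X \<and>
          (if r = \<infinity> then tuple_length X xs < \<infinity> else tuple_length X xs \<le> r)}"


section \<open>Edge-path groupoids\<close>

text \<open>
  Here \<open>K n\<close> is the set of \<open>n\<close>-simplices of a simplicial set of tuples, whose faces and
  degeneracies delete and repeat entries. \<open>Fwd x y\<close> is the generator \<open>x \<rightarrow> y\<close> given by the
  1-simplex \<open>(x, y)\<close> and \<open>Bwd x y\<close> is its formal inverse, a morphism \<open>y \<rightarrow> x\<close>.
  \<open>edge_word K x w y\<close> says that \<open>w\<close>, read from left to right, is a word from \<open>x\<close> to \<open>y\<close>.
\<close>

datatype 'a letter = Fwd 'a 'a | Bwd 'a 'a

fun edge_word :: "(nat \<Rightarrow> 'a list set) \<Rightarrow> 'a \<Rightarrow> 'a letter list \<Rightarrow> 'a \<Rightarrow> bool" where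
  "edge_word K x [] y \<longleftrightarrow> x = y \<and> [x] \<in> K 0"
| "edge_word K x (Fwd a b # w) y \<longleftrightarrow> a = x \<and> [a, b] \<in> K 1 \<and> edge_word K b w y"
| "edge_word K x (Bwd a b # w) y \<longleftrightarrow> b = x \<and> [a, b] \<in> K 1 \<and> edge_word K a w y"

text \<open>
  \<open>edge_equiv K x y\<close> is the congruence on words from \<open>x\<close> to \<open>y\<close> generated by the groupoid
  axioms for formal inverses and the relations of the edge-path groupoid.
\<close>

inductive edge_equiv ::
  "(nat \<Rightarrow> 'a list set) \<Rightarrow> 'a \<Rightarrow> 'a \<Rightarrow> 'a letter list \<Rightarrow> 'a letter list \<Rightarrow> bool"
  for K where
  refl: "edge_word K x w y \<Longrightarrow> edge_equiv K x y w w"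
| sym: "edge_equiv K x y v w \<Longrightarrow> edge_equiv K x y w v"
| trans: "edge_equiv K x y u v \<Longrightarrow> edge_equiv K x y v w \<Longrightarrow> edge_equiv K x y u w"
| append: "edge_equiv K x y v v' \<Longrightarrow> edge_equiv K y z w w' \<Longrightarrow> edge_equiv K x z (v @ w) (v' @ w')"
| right_inverse: "[x, y] \<in> K 1 \<Longrightarrow> edge_equiv K x x [Fwd x y, Bwd x y] []"
| left_inverse: "[x, y] \<in> K 1 \<Longrightarrow> edge_equiv K y y [Bwd x y, Fwd x y] []"
| degenerate: "[x] \<in> K 0 \<Longrightarrow> edge_equiv K x x [Fwd x x] []"
| simplex2: "[x, y, z] \<in> K 2 \<Longrightarrow> edge_equiv K x z [Fwd x z] [Fwd x y, Fwd y z]"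

definition groupoid_hom :: "(nat \<Rightarrow> 'a list set) \<Rightarrow> 'a \<Rightarrow> 'a \<Rightarrow> 'a letter list set set" where
  "groupoid_hom K x y = {w. edge_word K x w y} // {(v, w). edge_equiv K x y v w}"

text \<open>The composite of \<open>A : x \<rightarrow> y\<close> followed by \<open>B : y \<rightarrow> z\<close>.\<close>

definition groupoid_comp ::
  "(nat \<Rightarrow> 'a list set) \<Rightarrow> 'a \<Rightarrow> 'a \<Rightarrow> 'a letter list set \<Rightarrow> 'a letter list set \<Rightarrow> 'a letter list set"
  where
  "groupoid_comp K x z A B = {w. \<exists>u \<in> A. \<exists>v \<in> B. edge_equiv K x z (u @ v) w}"

definition groupoid_id :: "(nat \<Rightarrow> 'a list set) \<Rightarrow> 'a \<Rightarrow> 'a letter list set" where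
  "groupoid_id K x = {w. edge_equiv K x x [] w}"

definition fundamental_group :: "enat \<Rightarrow> 'a pair_pre_digraph \<Rightarrow> 'a \<Rightarrow> 'a letter list set monoid" where
  "fundamental_group r X x0 =
     \<lparr> carrier = groupoid_hom (nerve r X) x0 x0,
       mult = groupoid_comp (nerve r X) x0 x0,
       one = groupoid_id (nerve r X) x0 \<rparr>"

text \<open>
  The homomorphism from the fundamental group of \<open>X\<close> at \<open>x0\<close> to that of \<open>Y\<close> at \<open>f x0\<close>
  induced by a map \<open>f\<close>. The domain enters only through the class \<open>A\<close>.
\<close>

definition induced_hom ::
  "enat \<Rightarrow> 'b pair_pre_digraph \<Rightarrow> ('a \<Rightarrow> 'b) \<Rightarrow> 'a \<Rightarrow> 'a letter list set \<Rightarrow> 'b letter list set"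
  where
  "induced_hom r Y f x0 A =
     {w. \<exists>v \<in> A. edge_equiv (nerve r Y) (f x0) (f x0) (map (map_letter f) v) w}"


section \<open>Paths and subdivisions\<close>

definition path_graphs :: "nat \<Rightarrow> nat pair_pre_digraph set" where
  "path_graphs n =
     {I. pverts I = {0..n} \<and>
         (\<forall>i<n. ((i, Suc i) \<in> parcs I) \<noteq> ((Suc i, i) \<in> parcs I)) \<and>
         parcs I \<subseteq> (\<Union>i<n. {(i, Suc i), (Suc i, i)})}"

definition reduced_path ::
  "'a pair_pre_digraph \<Rightarrow> nat \<Rightarrow> nat pair_pre_digraph \<Rightarrow> (nat \<Rightarrow> 'a) \<Rightarrow> bool" where
  "reduced_path X n I f \<longleftrightarrow> I \<in> path_graphs n \<and> graph_hom I X f"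

definition reduced_loop ::
  "'a pair_pre_digraph \<Rightarrow> nat \<Rightarrow> nat pair_pre_digraph \<Rightarrow> (nat \<Rightarrow> 'a) \<Rightarrow> bool" where
  "reduced_loop X n I f \<longleftrightarrow> reduced_path X n I f \<and> f 0 = f n"

definition loop_subgraph :: "'a pair_pre_digraph \<Rightarrow> 'a pair_pre_digraph \<Rightarrow> bool" where
  "loop_subgraph X L \<longleftrightarrow>
     is_subgraph L X \<and> (\<exists>n I f. reduced_loop X n I f \<and> L = graph_image f I)"

text \<open>
  A subgraph \<open>L\<close> may be represented by several reduced loops; a subpath of \<open>L\<close> is a subpath
  of any one of them.
\<close>

definition subpath_of :: "'a pair_pre_digraph \<Rightarrow> 'a pair_pre_digraph \<Rightarrow> 'a pair_pre_digraph \<Rightarrow> bool" where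
  "subpath_of X L A \<longleftrightarrow>
     (\<exists>n I f k l. reduced_loop X n I f \<and> L = graph_image f I \<and>
        k \<le> l \<and> l \<le> n \<and> A = graph_image f (induced_on I {k..l}))"

definition subdivides ::
  "'a pair_pre_digraph \<Rightarrow> 'a pair_pre_digraph \<Rightarrow> 'a pair_pre_digraph \<Rightarrow> 'a pair_pre_digraph \<Rightarrow> bool"
  where
  "subdivides X L L1 L2 \<longleftrightarrow>
     loop_subgraph X L \<and> loop_subgraph X L1 \<and> loop_subgraph X L2 \<and>
     subpath_of X L1 (graph_inter L1 L2) \<and> subpath_of X L2 (graph_inter L1 L2) \<and>
     L = graph_minus (graph_union L1 L2) (graph_inter L1 L2)"

text \<open>Iterated subdivision, including the trivial one in which \<open>L\<close> is left as it is.\<close>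

inductive subdivision ::
  "'a pair_pre_digraph \<Rightarrow> 'a pair_pre_digraph \<Rightarrow> 'a pair_pre_digraph list \<Rightarrow> bool"
  for X where
  trivial: "loop_subgraph X L \<Longrightarrow> subdivision X L [L]"
| step: "subdivision X L (As @ M # Bs) \<Longrightarrow> subdivides X M L1 L2 \<Longrightarrow>
    subdivision X L (As @ L1 # L2 # Bs)"


section \<open>Separable pairs\<close>

text \<open>
  The vertices \<open>u\<^sub>i\<close> and \<open>v\<^sub>i\<close> for \<open>i \<le> r\<close> are encoded so that exactly \<open>u\<^sub>0 = v\<^sub>0\<close> and
  \<open>u\<^sub>r = v\<^sub>r\<close>. For \<open>r = 1\<close> both branches of \<open>Gamma\<close> coincide and a single edge is left.
\<close>

definition Gamma_u :: "nat \<Rightarrow> nat \<Rightarrow> bool \<times> nat" where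
  "Gamma_u r i = (True, i)"

definition Gamma_v :: "nat \<Rightarrow> nat \<Rightarrow> bool \<times> nat" where
  "Gamma_v r i = (i = 0 \<or> i = r, i)"

definition Gamma :: "nat \<Rightarrow> (bool \<times> nat) pair_pre_digraph" where
  "Gamma r =
     \<lparr> pverts = Gamma_u r ` {0..r} \<union> Gamma_v r ` {0..r},
       parcs = (\<Union>i<r. {(Gamma_u r i, Gamma_u r (Suc i)), (Gamma_v r i, Gamma_v r (Suc i))}) \<rparr>"

definition degenerate_Gamma :: "nat \<Rightarrow> 'a pair_pre_digraph \<Rightarrow> 'a pair_pre_digraph \<Rightarrow> bool" where
  "degenerate_Gamma r X D \<longleftrightarrow> (\<exists>f. graph_map (Gamma r) X f \<and> D = graph_image f (Gamma r))"

definition subdivided_within ::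
  "nat \<Rightarrow> 'a pair_pre_digraph \<Rightarrow> 'a pair_pre_digraph \<Rightarrow> 'a pair_pre_digraph \<Rightarrow> bool" where
  "subdivided_within s X Y D \<longleftrightarrow>
     (\<exists>Ls. subdivision (graph_union X Y) D Ls \<and>
        (\<forall>L \<in> set Ls. degenerate_Gamma s (graph_union X Y) L \<and>
           (is_subgraph L X \<or> is_subgraph L Y)))"

definition separable :: "enat \<Rightarrow> 'a pair_pre_digraph \<Rightarrow> 'a pair_pre_digraph \<Rightarrow> bool" where
  "separable r X Y \<longleftrightarrow>
     (case r of
        enat n \<Rightarrow> (\<forall>D. degenerate_Gamma n (graph_union X Y) D \<longrightarrow> subdivided_within n X Y D)
      | \<infinity> \<Rightarrow> (\<forall>n \<ge> 1. \<forall>D. degenerate_Gamma n (graph_union X Y) D \<longrightarrow>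
                 (\<exists>s \<ge> n. subdivided_within s X Y D)))"


section \<open>Pushouts of groups\<close>

text \<open>
  The commutative square with sides \<open>f : A \<rightarrow> B\<close>, \<open>g : A \<rightarrow> C\<close>, \<open>h : B \<rightarrow> D\<close>, \<open>k : C \<rightarrow> D\<close> is a
  pushout. A definition cannot quantify over types, so the type of the elements of the test
  groups \<open>T\<close> is the parameter \<open>TYPE('t)\<close>; leaving \<open>'t\<close> free in a theorem gives the universal
  property with respect to all groups. Extensionality makes uniqueness on the carrier of \<open>D\<close>
  expressible by \<open>\<exists>!\<close>.
\<close>

definition is_pushout ::
  "'t itself \<Rightarrow> 'a monoid \<Rightarrow> 'b monoid \<Rightarrow> 'c monoid \<Rightarrow> 'd monoid \<Rightarrow>
   ('a \<Rightarrow> 'b) \<Rightarrow> ('a \<Rightarrow> 'c) \<Rightarrow> ('b \<Rightarrow> 'd) \<Rightarrow> ('c \<Rightarrow> 'd) \<Rightarrow> bool" where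
  "is_pushout (_ :: 't itself) A B C D f g h k \<longleftrightarrow>
     group A \<and> group B \<and> group C \<and> group D \<and>
     f \<in> hom A B \<and> g \<in> hom A C \<and> h \<in> hom B D \<and> k \<in> hom C D \<and>
     (\<forall>a \<in> carrier A. h (f a) = k (g a)) \<and>
     (\<forall>(T :: 't monoid) p q.
        group T \<and> p \<in> hom B T \<and> q \<in> hom C T \<and> (\<forall>a \<in> carrier A. p (f a) = q (g a)) \<longrightarrow>
        (\<exists>!u. u \<in> hom D T \<and> u \<in> extensional (carrier D) \<and>
           (\<forall>b \<in> carrier B. u (h b) = p b) \<and> (\<forall>c \<in> carrier C. u (k c) = q c)))"

end

theory Submission
  imports Defs
begin

text \<open>
  The proof compares homomorphisms out of \<open>\<pi>\<^sub>1\<^sup>r\<close> with \<open>T\<close>-valued cocycles on the \<open>r\<close>-nerve.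
  Choose for each vertex \<open>a\<close> in the component of \<open>x0\<close> a word from \<open>x0\<close> to \<open>a\<close>, inside \<open>X \<inter> Y\<close>,
  \<open>X\<close> or \<open>Y\<close> whenever \<open>a\<close> is a vertex of that graph; this is possible because \<open>X \<inter> Y\<close> is
  connected. A homomorphism \<open>p\<close> from a fundamental group to \<open>T\<close> then becomes a function on
  1-simplices satisfying the relations of 2-simplices, and \<open>p\<close> is recovered from it by
  evaluating words (\<open>edge_cocycle_hom_cocycle\<close>, \<open>hom_eq_value\<close>).

  Given compatible homomorphisms from the groups of \<open>X\<close> and \<open>Y\<close>, their cocycles \<open>P\<close> and \<open>Q\<close>
  agree on common edges and so give a value to each edge of \<open>X \<union> Y\<close>. A 1-simplex \<open>(a, b)\<close> of the
  nerve of \<open>X \<union> Y\<close> is a pair joined by a directed walk of some finite length at most \<open>r\<close>. Its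
  value has to be the product of the edge values along such a walk. These products form a
  cocycle as soon as they are independent of the walk. Two walks with common ends, prolonged by
  pauses to a common length \<open>n\<close>, are the branches of a degenerate \<open>\<Gamma>\<^sub>n\<close>, and what has to be shown
  is that the edge values have trivial product around it (\<open>walk_product_eq\<close>).

  This is where separability enters. Triviality around loops is expressed by a potential: a
  function \<open>\<phi>\<close> on vertices such that the value of every edge \<open>(x, y)\<close> of a subgraph is
  \<open>\<phi>(x)\<inverse> \<phi>(y)\<close>. A degenerate \<open>\<Gamma>\<^sub>s\<close> in \<open>X\<close> with \<open>s \<le> r\<close> and starting point \<open>a\<close> has the potential
  \<open>z \<mapsto> P a z\<close> (\<open>degenerate_Gamma_potential\<close>). If a loop is subdivided into two loops which have
  potentials, then these differ by a constant on the connected intersection and can be glued, so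
  the loop itself has a potential (\<open>potential_glue\<close>, \<open>subdivision_potential\<close>). Hence the
  degenerate \<open>\<Gamma>\<^sub>n\<close> that separability subdivides all have potentials. For finite \<open>r\<close> these are the
  ones with \<open>n = r\<close>; for \<open>r = \<infinity>\<close> all \<open>n \<ge> 1\<close> occur, with pieces that are degenerate \<open>\<Gamma>\<^sub>s\<close> for
  finite but unbounded \<open>s\<close>.

  Uniqueness holds because a cocycle is determined by its values on edges (\<open>glued_unique\<close>).
\<close>

declare One_nat_def [simp del]

section \<open>Words and the edge-path group\<close>

fun letter_inverse :: "'a letter \<Rightarrow> 'a letter" where
  "letter_inverse (Fwd a b) = Bwd a b"
| "letter_inverse (Bwd a b) = Fwd a b"

definition word_inverse :: "'a letter list \<Rightarrow> 'a letter list" where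
  "word_inverse w = rev (map letter_inverse w)"

lemma letter_inverse_involution [simp]: "letter_inverse (letter_inverse l) = l"
  by (cases l) auto

lemma word_inverse_simps [simp]:
  "word_inverse [] = []"
  "word_inverse (l # w) = word_inverse w @ [letter_inverse l]"
  "word_inverse (v @ w) = word_inverse w @ word_inverse v"
  "word_inverse (word_inverse w) = w"
  by (simp_all add: word_inverse_def rev_map o_def)

lemma edge_word_append:
  "edge_word K x v y \<Longrightarrow> edge_word K y w z \<Longrightarrow> edge_word K x (v @ w) z"
  by (induction K x v y rule: edge_word.induct) auto

text \<open>
  The morphism of the edge-path groupoid represented by a word.
\<close>

definition word_class ::
  "(nat \<Rightarrow> 'a list set) \<Rightarrow> 'a \<Rightarrow> 'a \<Rightarrow> 'a letter list \<Rightarrow> 'a letter list set" where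
  "word_class K x y w = {w'. edge_equiv K x y w w'}"

text \<open>
  The fundamental group depends on the graph only through its nerve, so the groupoid arguments are
  carried out for an arbitrary family of simplices.
\<close>

definition edge_group :: "(nat \<Rightarrow> 'a list set) \<Rightarrow> 'a \<Rightarrow> 'a letter list set monoid" where
  "edge_group K x0 =
     \<lparr> carrier = groupoid_hom K x0 x0, mult = groupoid_comp K x0 x0, one = groupoid_id K x0 \<rparr>"

lemma carrier_edge_group:
  "carrier (edge_group K x0) = word_class K x0 x0 ` {w. edge_word K x0 w x0}"
  by (auto simp: edge_group_def groupoid_hom_def quotient_def word_class_def)

text \<open>
  The family \<open>K\<close> stands for a simplicial set of tuples; edge paths involve its faces in dimensions
  at most two.
\<close>

locale edge_complex =
  fixes K :: "nat \<Rightarrow> 'a list set"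
  assumes face1: "[a, b] \<in> K 1 \<Longrightarrow> [a] \<in> K 0 \<and> [b] \<in> K 0"
    and face2: "[a, b, c] \<in> K 2 \<Longrightarrow> [a, b] \<in> K 1 \<and> [b, c] \<in> K 1 \<and> [a, c] \<in> K 1"
begin

lemma edge_word_ends: "edge_word K x w y \<Longrightarrow> [x] \<in> K 0 \<and> [y] \<in> K 0"
proof (induction w arbitrary: x)
  case (Cons l w)
  then show ?case by (cases l) (auto dest: face1)
qed simp

lemma edge_word_inverse: "edge_word K x w y \<Longrightarrow> edge_word K y (word_inverse w) x"
proof (induction w arbitrary: x)
  case (Cons l w)
  then show ?case
    by (cases l) (auto intro!: edge_word_append dest: face1)
qed simp

lemma word_class_cong: "edge_equiv K x y v w \<Longrightarrow> word_class K x y v = word_class K x y w"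
  unfolding word_class_def by (blast intro: edge_equiv.sym edge_equiv.trans)

lemma edge_equiv_in_context:
  assumes "edge_equiv K y z v v'" "edge_word K x u y" "edge_word K z t w"
  shows "edge_equiv K x w (u @ v @ t) (u @ v' @ t)"
  using assms by (intro edge_equiv.append edge_equiv.refl)

lemma edge_equiv_inverse:
  "edge_word K x w y \<Longrightarrow> edge_equiv K x x (w @ word_inverse w) []"
proof (induction w arbitrary: x)
  case Nil
  then show ?case by (auto intro: edge_equiv.refl)
next
  case (Cons l w)
  obtain z where l: "edge_word K x [l] z" and w: "edge_word K z w y"
    and ll: "edge_equiv K x x ([l] @ [letter_inverse l]) []"
    using Cons.prems
    by (cases l) (auto dest: face1 intro: edge_equiv.right_inverse edge_equiv.left_inverse)
  have "edge_equiv K x x ([l] @ (w @ word_inverse w) @ [letter_inverse l])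
      ([l] @ [] @ [letter_inverse l])"
    using edge_equiv_in_context[OF Cons.IH[OF w] l] edge_word_inverse[OF l] by simp
  then show ?case using ll edge_equiv.trans by force
qed

text \<open>
  Used to insert a detour \<open>v\<inverse> v\<close> to the base point in the middle of a loop, which
  cuts the loop into two loops.
\<close>

lemma edge_equiv_cancel:
  assumes "edge_word K x u y" "edge_word K z v y" "edge_word K y t w"
  shows "edge_equiv K x w (u @ word_inverse v @ v @ t) (u @ t)"
  using edge_equiv_in_context[OF edge_equiv_inverse[OF edge_word_inverse[OF assms(2)]] assms(1,3)]
  by simp

lemma mult_word_class:
  assumes "edge_word K x0 v x0" "edge_word K x0 w x0"
  shows "word_class K x0 x0 v \<otimes>\<^bsub>edge_group K x0\<^esub> word_class K x0 x0 w = word_class K x0 x0 (v @ w)"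
proof -
  have "edge_equiv K x0 x0 v v" "edge_equiv K x0 x0 w w"
    using assms by (auto intro: edge_equiv.refl)
  then show ?thesis
    unfolding edge_group_def groupoid_comp_def word_class_def monoid.simps
    by (blast intro: edge_equiv.append edge_equiv.trans)
qed

lemma one_edge_group: "\<one>\<^bsub>edge_group K x0\<^esub> = word_class K x0 x0 []"
  by (simp add: edge_group_def groupoid_id_def word_class_def)

lemma group_edge_group:
  assumes "[x0] \<in> K 0"
  shows "group (edge_group K x0)"
proof (rule groupI)
  fix A assume "A \<in> carrier (edge_group K x0)"
  then obtain w where w: "edge_word K x0 w x0" "A = word_class K x0 x0 w"
    by (auto simp: carrier_edge_group)
  have "word_class K x0 x0 (word_inverse w) \<otimes>\<^bsub>edge_group K x0\<^esub> A = \<one>\<^bsub>edge_group K x0\<^esub>"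
    using w edge_word_inverse[OF w(1)] edge_equiv_inverse[OF edge_word_inverse[OF w(1)]]
    by (simp add: mult_word_class one_edge_group word_class_cong)
  then show "\<exists>B\<in>carrier (edge_group K x0). B \<otimes>\<^bsub>edge_group K x0\<^esub> A = \<one>\<^bsub>edge_group K x0\<^esub>"
    using edge_word_inverse[OF w(1)] by (auto simp: carrier_edge_group)
qed (use assms in \<open>auto simp: carrier_edge_group mult_word_class one_edge_group edge_word_append\<close>)

end

lemma edge_word_mono:
  assumes "K \<le> K'"
  shows "edge_word K x w y \<Longrightarrow> edge_word K' x w y"
proof (induction w arbitrary: x)
  case Nil
  then show ?case using assms by (auto simp: le_fun_def)
next
  case (Cons l w)
  then show ?case using assms by (cases l) (auto simp: le_fun_def)
qed

lemma edge_equiv_mono: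
  assumes "K \<le> K'"
  shows "edge_equiv K x y v w \<Longrightarrow> edge_equiv K' x y v w"
proof (induction rule: edge_equiv.induct)
  case (trans x y u v w)
  then show ?case by (blast intro: edge_equiv.trans)
qed (use assms in \<open>auto simp: le_fun_def intro: edge_equiv.intros edge_word_mono[OF assms]\<close>)

text \<open>
  The map on classes induced by an inclusion of complexes is the identity on representatives.
\<close>

definition class_inclusion ::
  "(nat \<Rightarrow> 'a list set) \<Rightarrow> 'a \<Rightarrow> 'a letter list set \<Rightarrow> 'a letter list set" where
  "class_inclusion K x0 A = {w. \<exists>v\<in>A. edge_equiv K x0 x0 v w}"

lemma class_inclusion_word_class:
  assumes "K \<le> K'" "edge_word K x0 w x0"
  shows "class_inclusion K' x0 (word_class K x0 x0 w) = word_class K' x0 x0 w"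
proof -
  have "edge_equiv K x0 x0 w v \<Longrightarrow> edge_equiv K' x0 x0 w v" for v
    by (rule edge_equiv_mono[OF assms(1)])
  then show ?thesis
    using assms(2) unfolding class_inclusion_def word_class_def
    by (blast intro: edge_equiv.refl edge_equiv.trans)
qed

lemma class_inclusion_hom:
  assumes "edge_complex K" "edge_complex K'" "K \<le> K'"
  shows "class_inclusion K' x0 \<in> hom (edge_group K x0) (edge_group K' x0)"
proof (rule homI)
  interpret K: edge_complex K by fact
  interpret K': edge_complex K' by fact
  note mono = edge_word_mono[OF assms(3)]
    and incl = class_inclusion_word_class[OF assms(3)]
  fix A B assume "A \<in> carrier (edge_group K x0)" "B \<in> carrier (edge_group K x0)"
  then obtain v w where vw: "edge_word K x0 v x0" "A = word_class K x0 x0 v"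
      "edge_word K x0 w x0" "B = word_class K x0 x0 w"
    by (auto simp: carrier_edge_group)
  then show "class_inclusion K' x0 A \<in> carrier (edge_group K' x0)"
    using mono incl by (auto simp: carrier_edge_group)
  show "class_inclusion K' x0 (A \<otimes>\<^bsub>edge_group K x0\<^esub> B)
      = class_inclusion K' x0 A \<otimes>\<^bsub>edge_group K' x0\<^esub> class_inclusion K' x0 B"
    using vw mono by (simp add: K.mult_word_class K'.mult_word_class incl edge_word_append)
qed

section \<open>Cocycles and homomorphisms\<close>

primrec letter_value :: "('t, 'm) monoid_scheme \<Rightarrow> ('a \<Rightarrow> 'a \<Rightarrow> 't) \<Rightarrow> 'a letter \<Rightarrow> 't" where
  "letter_value T c (Fwd a b) = c a b"
| "letter_value T c (Bwd a b) = inv\<^bsub>T\<^esub> (c a b)"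

primrec word_value :: "('t, 'm) monoid_scheme \<Rightarrow> ('a \<Rightarrow> 'a \<Rightarrow> 't) \<Rightarrow> 'a letter list \<Rightarrow> 't" where
  "word_value T c [] = \<one>\<^bsub>T\<^esub>"
| "word_value T c (l # w) = letter_value T c l \<otimes>\<^bsub>T\<^esub> word_value T c w"

lemma word_value_cong:
  assumes "\<And>a b. [a, b] \<in> K 1 \<Longrightarrow> c a b = c' a b"
  shows "edge_word K x w y \<Longrightarrow> word_value T c w = word_value T c' w"
proof (induction w arbitrary: x)
  case (Cons l w)
  then show ?case by (cases l) (auto simp: assms)
qed simp

text \<open>
  A cocycle assigns group elements to 1-simplices so that the relations of the edge-path groupoid
  hold. It is the same as a functor from that groupoid to the one-object groupoid \<open>T\<close>, given on
  generators; values off the complex are kept in the carrier so that every word has a value there.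
\<close>

locale edge_cocycle = edge_complex K + group T
  for K :: "nat \<Rightarrow> 'a list set" and T (structure) +
  fixes c :: "'a \<Rightarrow> 'a \<Rightarrow> 't"
  assumes closed [simp]: "c a b \<in> carrier T"
    and unit [simp]: "[a] \<in> K 0 \<Longrightarrow> c a a = \<one>"
    and cocycle: "[a, b, d] \<in> K 2 \<Longrightarrow> c a b \<otimes> c b d = c a d"
begin

lemma letter_value_closed [simp]: "letter_value T c l \<in> carrier T"
  by (cases l) auto

lemma value_closed [simp]: "word_value T c w \<in> carrier T"
  by (induction w) auto

lemma value_append: "word_value T c (v @ w) = word_value T c v \<otimes> word_value T c w"
  by (induction v) (auto simp: m_assoc)

lemma value_edge_equiv: "edge_equiv K x y v w \<Longrightarrow> word_value T c v = word_value T c w"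
proof (induction rule: edge_equiv.induct)
  case (trans x y u v w)
  then show ?case by metis
next
  case (append x y v v' z w w')
  then show ?case by (simp only: value_append)
qed (simp_all add: cocycle)

definition value_hom :: "'a \<Rightarrow> 'a letter list set \<Rightarrow> 't" where
  "value_hom x0 = (\<lambda>A\<in>carrier (edge_group K x0). word_value T c (SOME w. w \<in> A))"

lemma value_hom_word_class:
  assumes "edge_word K x0 w x0"
  shows "value_hom x0 (word_class K x0 x0 w) = word_value T c w"
proof -
  have "w \<in> word_class K x0 x0 w"
    using assms by (simp add: word_class_def edge_equiv.refl)
  then have "(SOME v. v \<in> word_class K x0 x0 w) \<in> word_class K x0 x0 w"
    by (rule someI)
  then have "word_value T c (SOME v. v \<in> word_class K x0 x0 w) = word_value T c w"
    unfolding word_class_def mem_Collect_eq by (rule value_edge_equiv[symmetric])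
  then show ?thesis
    using assms by (simp add: value_hom_def carrier_edge_group)
qed

lemma value_hom: "value_hom x0 \<in> hom (edge_group K x0) T"
proof (rule homI)
  fix A B assume "A \<in> carrier (edge_group K x0)" "B \<in> carrier (edge_group K x0)"
  then obtain v w where "edge_word K x0 v x0" "A = word_class K x0 x0 v"
      "edge_word K x0 w x0" "B = word_class K x0 x0 w"
    by (auto simp: carrier_edge_group)
  then show "value_hom x0 (A \<otimes>\<^bsub>edge_group K x0\<^esub> B) = value_hom x0 A \<otimes> value_hom x0 B"
    by (simp add: mult_word_class value_hom_word_class edge_word_append value_append)
qed (auto simp: carrier_edge_group value_hom_word_class)

end

text \<open>
  To turn a homomorphism of fundamental groups into a cocycle, each vertex \<open>a\<close> in the component of
  the base point is joined to it by a word \<open>\<gamma> a\<close>. The set \<open>R\<close> stands for that component; it is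
  a parameter because the same words and the same \<open>R\<close> are shared by several complexes below.
\<close>

locale based_complex = edge_complex K for K :: "nat \<Rightarrow> 'a list set" +
  fixes x0 :: 'a and R :: "'a set" and \<gamma> :: "'a \<Rightarrow> 'a letter list"
  assumes base: "[x0] \<in> K 0" "x0 \<in> R" "\<gamma> x0 = []"
    and transport: "a \<in> R \<Longrightarrow> [a] \<in> K 0 \<Longrightarrow> edge_word K x0 (\<gamma> a) a"
    and invariant: "[a, b] \<in> K 1 \<Longrightarrow> a \<in> R \<longleftrightarrow> b \<in> R"
begin

definition edge_loop :: "'a \<Rightarrow> 'a \<Rightarrow> 'a letter list" where
  "edge_loop a b = \<gamma> a @ Fwd a b # word_inverse (\<gamma> b)"

text \<open>
  Outside \<open>R\<close> the trivial element is a consistent choice, since a 1-simplex never leaves \<open>R\<close>.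
\<close>

definition hom_cocycle ::
  "('t, 'm) monoid_scheme \<Rightarrow> ('a letter list set \<Rightarrow> 't) \<Rightarrow> 'a \<Rightarrow> 'a \<Rightarrow> 't" where
  "hom_cocycle T p a b =
     (if [a, b] \<in> K 1 \<and> a \<in> R then p (word_class K x0 x0 (edge_loop a b)) else \<one>\<^bsub>T\<^esub>)"

lemma edge_word_edge_loop: "[a, b] \<in> K 1 \<Longrightarrow> a \<in> R \<Longrightarrow> edge_word K x0 (edge_loop a b) x0"
  unfolding edge_loop_def
  using face1[of a b] invariant[of a b]
  by (auto intro!: edge_word_append[OF transport] edge_word_inverse transport)

context
  fixes T (structure) and p
  assumes T: "group T" and p: "p \<in> hom (edge_group K x0) T"
begin

interpretation T: group T by (rule T)

lemma hom_class_closed: "edge_word K x0 w x0 \<Longrightarrow> p (word_class K x0 x0 w) \<in> carrier T"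
  using p by (auto simp: hom_def carrier_edge_group)

lemma hom_class_mult:
  "edge_word K x0 v x0 \<Longrightarrow> edge_word K x0 w x0 \<Longrightarrow>
    p (word_class K x0 x0 v) \<otimes> p (word_class K x0 x0 w) = p (word_class K x0 x0 (v @ w))"
  using hom_mult[OF p, of "word_class K x0 x0 v" "word_class K x0 x0 w"]
  by (simp add: carrier_edge_group mult_word_class)

lemma hom_class_Nil: "p (word_class K x0 x0 []) = \<one>"
  using hom_class_mult[of "[]" "[]"] hom_class_closed[of "[]"] base T.l_cancel_one by auto

lemma hom_class_inverse:
  assumes "edge_word K x0 w x0"
  shows "p (word_class K x0 x0 (word_inverse w)) = inv (p (word_class K x0 x0 w))"
proof (rule T.inv_equality[symmetric])
  show "p (word_class K x0 x0 (word_inverse w)) \<otimes> p (word_class K x0 x0 w) = \<one>"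
    using hom_class_mult[OF edge_word_inverse[OF assms] assms]
      word_class_cong[OF edge_equiv_inverse[OF edge_word_inverse[OF assms]]]
    by (simp add: hom_class_Nil)
qed (use assms hom_class_closed edge_word_inverse in auto)

lemma hom_cocycle_closed: "hom_cocycle T p a b \<in> carrier T"
  by (auto simp: hom_cocycle_def hom_class_closed edge_word_edge_loop)

text \<open>
  Cutting a word at its vertices by the detours \<open>\<gamma>\<close> makes it a product of the loops
  \<open>edge_loop a b\<close> and their inverses.
\<close>

lemma value_hom_cocycle:
  assumes "edge_word K x w y" "x \<in> R"
  shows "p (word_class K x0 x0 (\<gamma> x @ w @ word_inverse (\<gamma> y))) = word_value T (hom_cocycle T p) w"
  using assms
proof (induction w arbitrary: x)
  case Nil
  then have "edge_equiv K x0 x0 (\<gamma> y @ word_inverse (\<gamma> y)) []"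
    by (intro edge_equiv_inverse[OF transport]) auto
  then show ?case
    using Nil by (simp add: word_class_cong hom_class_Nil)
next
  case (Cons l w)
  obtain z where l: "edge_word K x [l] z" and w: "edge_word K z w y"
    using Cons.prems by (cases l) (auto dest: face1)
  have z: "z \<in> R"
    using l Cons.prems(2) invariant by (cases l) auto
  have y: "y \<in> R" using w z
    proof (induction w arbitrary: z)
    case (Cons l w)
    then show ?case by (cases l) (auto simp: invariant)
  qed simp
  have \<gamma>: "edge_word K x0 (\<gamma> x) x" "edge_word K x0 (\<gamma> y) y" "edge_word K x0 (\<gamma> z) z"
    using transport Cons.prems(2) z y edge_word_ends l w by blast+
  have ll: "edge_word K x0 (\<gamma> x @ [l] @ word_inverse (\<gamma> z)) x0"
    using \<gamma> l by (intro edge_word_append edge_word_inverse)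
  have ww: "edge_word K x0 (\<gamma> z @ w @ word_inverse (\<gamma> y)) x0"
    using \<gamma> w by (intro edge_word_append edge_word_inverse)
  have "edge_equiv K x0 x0 ((\<gamma> x @ [l]) @ word_inverse (\<gamma> z) @ \<gamma> z @ (w @ word_inverse (\<gamma> y)))
     ((\<gamma> x @ [l]) @ (w @ word_inverse (\<gamma> y)))"
    using \<gamma> l w by (intro edge_equiv_cancel edge_word_append edge_word_inverse)
  then have "p (word_class K x0 x0 (\<gamma> x @ (l # w) @ word_inverse (\<gamma> y)))
    = p (word_class K x0 x0 (\<gamma> x @ [l] @ word_inverse (\<gamma> z)))
      \<otimes> p (word_class K x0 x0 (\<gamma> z @ w @ word_inverse (\<gamma> y)))"
    unfolding hom_class_mult[OF ll ww] by (simp add: word_class_cong)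
  moreover have "p (word_class K x0 x0 (\<gamma> z @ w @ word_inverse (\<gamma> y)))
    = word_value T (hom_cocycle T p) w"
    using Cons.IH[OF w z] .
  moreover have "word_value T (hom_cocycle T p) (l # w)
    = p (word_class K x0 x0 (\<gamma> x @ [l] @ word_inverse (\<gamma> z))) \<otimes> word_value T (hom_cocycle T p) w"
  proof (cases l)
    case (Fwd a b)
    then show ?thesis using l Cons.prems(2)
      by (auto simp: hom_cocycle_def edge_loop_def)
  next
    case (Bwd a b)
    then have ab: "[a, b] \<in> K 1" "a \<in> R" "x = b" "z = a" using l z by auto
    have "word_inverse (edge_loop a b) = \<gamma> x @ [l] @ word_inverse (\<gamma> z)"
      using Bwd ab by (simp add: edge_loop_def)
    then show ?thesis
      using hom_class_inverse[OF edge_word_edge_loop[OF ab(1,2)]] ab Bwd by (simp add: hom_cocycle_def)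
  qed
  ultimately show ?case by simp
qed

lemma edge_cocycle_hom_cocycle: "edge_cocycle K T (hom_cocycle T p)"
proof unfold_locales
  fix a b show "hom_cocycle T p a b \<in> carrier T" by (rule hom_cocycle_closed)
next
  fix a assume a: "[a] \<in> K 0"
  show "hom_cocycle T p a a = \<one>"
  proof (cases "a \<in> R")
    case True
    have "edge_equiv K x0 x0 (\<gamma> a @ [Fwd a a] @ word_inverse (\<gamma> a))
       (\<gamma> a @ [] @ word_inverse (\<gamma> a))"
      using a True edge_equiv_in_context[OF edge_equiv.degenerate transport]
      by (blast intro: edge_word_inverse transport)
    moreover have "edge_equiv K x0 x0 (\<gamma> a @ [] @ word_inverse (\<gamma> a)) []"
      using edge_equiv_inverse[OF transport] a True by simp
    ultimately show ?thesis
      by (auto simp: hom_cocycle_def edge_loop_def hom_class_Nil dest!: word_class_cong)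
  qed (simp add: hom_cocycle_def)
next
  fix a b d assume abd: "[a, b, d] \<in> K 2"
  show "hom_cocycle T p a b \<otimes> hom_cocycle T p b d = hom_cocycle T p a d"
  proof (cases "a \<in> R")
    case True
    have s: "[a, b] \<in> K 1" "[b, d] \<in> K 1" "[a, d] \<in> K 1"
      using face2[OF abd] by auto
    have R: "b \<in> R" "d \<in> R" using True invariant s by auto
    have \<gamma>: "edge_word K x0 (\<gamma> a) a" "edge_word K x0 (\<gamma> d) d"
      using transport True R s face1 by blast+
    have "edge_equiv K x0 x0 (\<gamma> a @ [Fwd a d] @ word_inverse (\<gamma> d))
       (\<gamma> a @ [Fwd a b, Fwd b d] @ word_inverse (\<gamma> d))"
      using edge_equiv_in_context[OF edge_equiv.simplex2[where K = K, OF abd] \<gamma>(1) edge_word_inverse[OF \<gamma>(2)]] .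
    then have "hom_cocycle T p a d =
        p (word_class K x0 x0 (\<gamma> a @ [Fwd a b, Fwd b d] @ word_inverse (\<gamma> d)))"
      using True s by (auto simp: hom_cocycle_def edge_loop_def dest!: word_class_cong)
    also have "\<dots> = word_value T (hom_cocycle T p) [Fwd a b, Fwd b d]"
      using s True face1 by (intro value_hom_cocycle) auto
    finally show ?thesis by (simp add: hom_cocycle_closed)
  next
    case False
    then show ?thesis using face2[OF abd] invariant[of a b] by (simp add: hom_cocycle_def)
  qed
qed

text \<open>
  Because \<open>\<gamma> x0\<close> is empty, no conjugation appears at the base point: the homomorphism is recovered
  from its cocycle.
\<close>

lemma hom_eq_value:
  assumes "edge_word K x0 w x0"
  shows "p (word_class K x0 x0 w) = word_value T (hom_cocycle T p) w"
  using value_hom_cocycle[OF assms] base by simp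

end
end

section \<open>Lazy walks and the simplices of the nerve\<close>

text \<open>
  Maps of directed graphs may collapse edges, so a branch of a degenerate \<open>\<Gamma>\<^sub>n\<close> is a walk that may
  pause. Pausing also allows every walk to be prolonged to any given length.
\<close>

definition lazy_walk :: "'a pair_pre_digraph \<Rightarrow> (nat \<Rightarrow> 'a) \<Rightarrow> nat \<Rightarrow> bool" where
  "lazy_walk Z s n \<longleftrightarrow>
     s 0 \<in> pverts Z \<and> (\<forall>i<n. s i = s (Suc i) \<or> (s i, s (Suc i)) \<in> parcs Z)"

definition walk_append :: "nat \<Rightarrow> (nat \<Rightarrow> 'a) \<Rightarrow> (nat \<Rightarrow> 'a) \<Rightarrow> nat \<Rightarrow> 'a" where
  "walk_append n s t = (\<lambda>i. if i \<le> n then s i else t (i - n))"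

lemma lazy_walk_append:
  assumes "lazy_walk Z s n" "lazy_walk Z t m" "s n = t 0"
  shows "lazy_walk Z (walk_append n s t) (n + m)"
  unfolding lazy_walk_def
proof (intro conjI allI impI)
  show "walk_append n s t 0 \<in> pverts Z" using assms by (simp add: walk_append_def lazy_walk_def)
next
  fix i assume i: "i < n + m"
  consider "i < n" | "i = n" | "i > n" by linarith
  then show "walk_append n s t i = walk_append n s t (Suc i) \<or>
      (walk_append n s t i, walk_append n s t (Suc i)) \<in> parcs Z"
  proof cases
    case 1 then show ?thesis using assms(1) by (simp add: walk_append_def lazy_walk_def)
  next
    case 2
    then have "t 0 = t (Suc 0) \<or> (t 0, t (Suc 0)) \<in> parcs Z"
      using i assms(2) by (simp add: lazy_walk_def)
    then show ?thesis using 2 assms(3) by (simp add: walk_append_def)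
  next
    case 3
    then have "t (i - n) = t (Suc (i - n)) \<or> (t (i - n), t (Suc (i - n))) \<in> parcs Z"
      using i assms(2) by (simp add: lazy_walk_def)
    then show ?thesis using 3 by (simp add: walk_append_def Suc_diff_le)
  qed
qed

lemma walk_append_ends:
  "s n = t 0 \<Longrightarrow> walk_append n s t 0 = s 0 \<and> walk_append n s t (n + m) = t m"
  by (cases m) (auto simp: walk_append_def)

lemma lazy_walk_pad:
  assumes "lazy_walk Z s n"
  shows "lazy_walk Z (\<lambda>i. s (min i n)) m"
  using assms by (auto simp: lazy_walk_def min_def not_le Suc_le_eq)

text \<open>
  Distances count the edges of shortest walks; since walks may pause, a distance at most \<open>n\<close> is
  witnessed by a walk of length exactly \<open>n\<close>.
\<close>

context pair_wf_digraph
begin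

lemma lazy_walk_in_verts: "lazy_walk G s n \<Longrightarrow> i \<le> n \<Longrightarrow> s i \<in> pverts G"
proof (induction i)
  case (Suc i)
  then show ?case
    using arc_snd_in_verts[of "(s i, s (Suc i))"] unfolding lazy_walk_def
    by (metis Suc_le_eq less_imp_le_nat snd_conv)
qed (simp add: lazy_walk_def)

lemma awalk_of_lazy_walk:
  "lazy_walk G s n \<Longrightarrow> \<exists>p. awalk (s 0) p (s n) \<and> length p \<le> n"
proof (induction n)
  case 0
  then show ?case by (auto simp: lazy_walk_def awalk_Nil_iff)
next
  case (Suc n)
  then obtain p where p: "awalk (s 0) p (s n)" "length p \<le> n" by (auto simp: lazy_walk_def)
  consider "s n = s (Suc n)" | "(s n, s (Suc n)) \<in> parcs G"
    using Suc.prems by (auto simp: lazy_walk_def)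
  then show ?case
  proof cases
    case 1 then show ?thesis using p by (intro exI[of _ p]) auto
  next
    case 2
    then have "awalk (s 0) (p @ [(s n, s (Suc n))]) (s (Suc n))"
      using p arc_snd_in_verts[OF 2] by (intro awalk_appendI) (auto simp: awalk_simps)
    then show ?thesis using p(2) by (metis length_append_singleton Suc_le_mono)
  qed
qed

lemma lazy_walk_of_awalk:
  "awalk a p b \<Longrightarrow> \<exists>s. lazy_walk G s (length p) \<and> s 0 = a \<and> s (length p) = b"
proof (induction p arbitrary: b rule: rev_induct)
  case Nil
  then show ?case by (intro exI[of _ "\<lambda>_. a"]) (auto simp: lazy_walk_def awalk_Nil_iff)
next
  case (snoc e p)
  then have e: "awalk a p (fst e)" "e \<in> parcs G" "snd e = b"
    by (auto simp: awalk_append_iff awalk_simps)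
  obtain s where s: "lazy_walk G s (length p)" "s 0 = a" "s (length p) = fst e"
    using snoc.IH[OF e(1)] by auto
  have "(fst e, b) \<in> parcs G" using e by auto
  then have "lazy_walk G (s(Suc (length p) := b)) (Suc (length p))"
    using s by (auto simp: lazy_walk_def less_Suc_eq)
  then show ?case using s by (intro exI[of _ "s(Suc (length p) := b)"]) (simp add: fun_upd_def)
qed

lemma path_dist_le_iff:
  "path_dist G a b \<le> enat n \<longleftrightarrow> (\<exists>s. lazy_walk G s n \<and> s 0 = a \<and> s n = b)"
proof
  assume le: "path_dist G a b \<le> enat n"
  let ?L = "(\<lambda>p. enat (length p)) ` {p. awalk a p b}"
  have "?L \<noteq> {}"
    using le unfolding path_dist_def by (metis Inf_empty enat_ord_code(5) top_enat_def)
  then have "Inf ?L \<in> ?L" by (auto intro: wellorder_InfI)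
  then obtain p where p: "awalk a p b" "enat (length p) = path_dist G a b"
    unfolding path_dist_def by auto
  then obtain s where s: "lazy_walk G s (length p)" "s 0 = a" "s (length p) = b"
    using lazy_walk_of_awalk by blast
  have "length p \<le> n" using le p(2) by (metis enat_ord_simps(1))
  then show "\<exists>s. lazy_walk G s n \<and> s 0 = a \<and> s n = b"
    using s lazy_walk_pad[OF s(1), of n]
    by (intro exI[of _ "\<lambda>i. s (min i (length p))"]) (auto simp: min_def)
next
  assume "\<exists>s. lazy_walk G s n \<and> s 0 = a \<and> s n = b"
  then obtain p where p: "awalk a p b" "length p \<le> n" using awalk_of_lazy_walk by blast
  then have "path_dist G a b \<le> enat (length p)"
    unfolding path_dist_def by (intro INF_lower) auto
  then show "path_dist G a b \<le> enat n" using p(2) by (meson enat_ord_simps(1) order_trans)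
qed

lemma path_dist_step:
  "a \<in> pverts G \<Longrightarrow> a = b \<or> (a, b) \<in> parcs G \<Longrightarrow> path_dist G a b \<le> enat 1"
  unfolding path_dist_le_iff
  by (intro exI[of _ "\<lambda>i. if i = 0 then a else b"]) (auto simp: lazy_walk_def)

lemma path_dist_lazy_walk: "lazy_walk G s n \<Longrightarrow> path_dist G (s 0) (s n) \<le> enat n"
  unfolding path_dist_le_iff by blast

lemma path_dist_triangle:
  "path_dist G a b \<le> enat n \<Longrightarrow> path_dist G b d \<le> enat m \<Longrightarrow> path_dist G a d \<le> enat (n + m)"
  unfolding path_dist_le_iff using lazy_walk_append walk_append_ends by metis

end

lemma vertex_in_nerve: "[a] \<in> nerve r Z 0 \<longleftrightarrow> a \<in> pverts Z"
  by (auto simp: nerve_def tuple_length_def)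

text \<open>
  Phrased with natural number bounds, the description of simplices is the same for finite \<open>r\<close> and
  for \<open>r = \<infinity>\<close>.
\<close>

lemma edge_in_nerve:
  "[a, b] \<in> nerve r Z 1 \<longleftrightarrow>
     a \<in> pverts Z \<and> b \<in> pverts Z \<and> (\<exists>n. enat n \<le> r \<and> path_dist Z a b \<le> enat n)"
proof -
  have "tuple_length Z [a, b] = path_dist Z a b" by (simp add: tuple_length_def)
  moreover have "(if r = \<infinity> then d < \<infinity> else d \<le> r) \<longleftrightarrow> (\<exists>n. enat n \<le> r \<and> d \<le> enat n)" for d :: enat
    by (cases r; cases d) auto
  moreover have "[a, b] \<in> nerve r Z 1 \<longleftrightarrow> a \<in> pverts Z \<and> b \<in> pverts Z \<and>
      (if r = \<infinity> then tuple_length Z [a, b] < \<infinity> else tuple_length Z [a, b] \<le> r)"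
    by (simp add: nerve_def One_nat_def)
  ultimately show ?thesis by presburger
qed

lemma triangle_in_nerve:
  "[a, b, d] \<in> nerve r Z 2 \<longleftrightarrow>
     a \<in> pverts Z \<and> b \<in> pverts Z \<and> d \<in> pverts Z \<and>
     (\<exists>n m. enat (n + m) \<le> r \<and> path_dist Z a b \<le> enat n \<and> path_dist Z b d \<le> enat m)"
proof -
  have "tuple_length Z [a, b, d] = path_dist Z a b + path_dist Z b d"
    by (simp add: tuple_length_def numeral_2_eq_2 One_nat_def)
  moreover have "(if r = \<infinity> then d + e < \<infinity> else d + e \<le> r) \<longleftrightarrow>
      (\<exists>n m. enat (n + m) \<le> r \<and> d \<le> enat n \<and> e \<le> enat m)" for d e :: enat
    by (cases r; cases d; cases e) (auto intro: order_trans[OF add_mono])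
  moreover have "[a, b, d] \<in> nerve r Z 2 \<longleftrightarrow> a \<in> pverts Z \<and> b \<in> pverts Z \<and> d \<in> pverts Z \<and>
      (if r = \<infinity> then tuple_length Z [a, b, d] < \<infinity> else tuple_length Z [a, b, d] \<le> r)"
    by (simp add: nerve_def numeral_2_eq_2)
  ultimately show ?thesis by presburger
qed

lemma (in pair_wf_digraph) edge_complex_nerve: "edge_complex (nerve r G)"
proof
  fix a b d assume "[a, b, d] \<in> nerve r G 2"
  then obtain n m where *: "a \<in> pverts G" "b \<in> pverts G" "d \<in> pverts G"
      "enat (n + m) \<le> r" "path_dist G a b \<le> enat n" "path_dist G b d \<le> enat m"
    by (auto simp: triangle_in_nerve)
  moreover have "enat n \<le> r" "enat m \<le> r"
    using *(4) by (meson enat_ord_simps(1) le_add1 le_add2 order_trans)+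
  ultimately show "[a, b] \<in> nerve r G 1 \<and> [b, d] \<in> nerve r G 1 \<and> [a, d] \<in> nerve r G 1"
    using path_dist_triangle by (auto simp: edge_in_nerve)
qed (auto simp: vertex_in_nerve edge_in_nerve)

lemma (in pair_wf_digraph) arc_in_nerve:
  assumes "1 \<le> r" "(a, b) \<in> parcs G"
  shows "[a, b] \<in> nerve r G 1"
  using assms path_dist_step[of a b] arc_fst_in_verts[OF assms(2)] arc_snd_in_verts[OF assms(2)]
  by (auto simp: edge_in_nerve one_enat_def)

lemma nerve_mono:
  assumes "pverts Z \<subseteq> pverts U" "parcs Z \<subseteq> parcs U"
  shows "nerve r Z \<le> nerve r U"
proof (rule le_funI)
  fix n
  have "pre_digraph.awalk (with_proj Z) x p y \<Longrightarrow> pre_digraph.awalk (with_proj U) x p y" for x p y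
    using assms by (auto simp: pre_digraph.awalk_def cas_with_proj_eq)
  then have "path_dist U x y \<le> path_dist Z x y" for x y
    unfolding path_dist_def by (intro INF_superset_mono) auto
  then have "tuple_length U xs \<le> tuple_length Z xs" for xs
    unfolding tuple_length_def by (intro sum_mono)
  then have "tuple_length Z xs < \<infinity> \<Longrightarrow> tuple_length U xs < \<infinity>"
    "tuple_length Z xs \<le> r \<Longrightarrow> tuple_length U xs \<le> r" for xs
    by (meson le_less_trans order_trans)+
  then show "nerve r Z n \<le> nerve r U n"
    using assms(1) unfolding nerve_def by (auto simp del: less_infinityE enat_ord_simps split: if_splits)
qed

section \<open>Products along walks, and potentials\<close>

lemma graph_image_arc:
  "(x, y) \<in> parcs G \<Longrightarrow> f x = f y \<or> (f x, f y) \<in> parcs (graph_image f G)"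
  by (auto simp: graph_image_def)

primrec walk_product ::
  "('t, 'm) monoid_scheme \<Rightarrow> ('a \<Rightarrow> 'a \<Rightarrow> 't) \<Rightarrow> (nat \<Rightarrow> 'a) \<Rightarrow> nat \<Rightarrow> 't" where
  "walk_product T F s 0 = \<one>\<^bsub>T\<^esub>"
| "walk_product T F s (Suc n) = walk_product T F s n \<otimes>\<^bsub>T\<^esub> F (s n) (s (Suc n))"

lemma walk_product_cong:
  "(\<And>i. i < n \<Longrightarrow> F (s i) (s (Suc i)) = F' (t i) (t (Suc i))) \<Longrightarrow>
    walk_product T F s n = walk_product T F' t n"
  by (induction n) auto

context group
begin

lemma walk_product_closed:
  "(\<And>a b. F a b \<in> carrier G) \<Longrightarrow> walk_product G F s n \<in> carrier G"
  by (induction n) auto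

lemma walk_product_append:
  assumes "\<And>a b. F a b \<in> carrier G" "s n = t 0"
  shows "walk_product G F (walk_append n s t) (n + m) = walk_product G F s n \<otimes> walk_product G F t m"
proof (induction m)
  case 0
  have "walk_product G F (walk_append n s t) n = walk_product G F s n"
    by (rule walk_product_cong) (simp add: walk_append_def)
  then show ?case using walk_product_closed[of F] assms(1) by simp
next
  case (Suc m)
  have "walk_append n s t (n + m) = t m" "walk_append n s t (Suc (n + m)) = t (Suc m)"
    using walk_append_ends[where s = s and t = t and n = n, OF assms(2)] by (metis add_Suc_right)+
  then show ?case using Suc walk_product_closed[of F] assms(1) by (simp add: m_assoc)
qed

lemma walk_product_pad:
  assumes "\<And>a b. F a b \<in> carrier G" "\<And>a. F a a = \<one>" "n \<le> m"
  shows "walk_product G F (\<lambda>i. s (min i n)) m = walk_product G F s n"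
  using assms(3)
proof (induction m rule: dec_induct)
  case base
  show ?case by (rule walk_product_cong) (simp add: min_def)
next
  case (step m)
  then show ?case using assms(1,2) walk_product_closed[of F] by (simp add: min_def)
qed

text \<open>
  A potential exhibits \<open>F\<close> as a coboundary on the subgraph \<open>D\<close>, so that \<open>F\<close> has trivial product
  around every loop in \<open>D\<close>. This notion refers to the subgraph alone. That matters because a
  subdivision only provides subgraphs: the same subgraph can be traversed by essentially different
  loops, and no particular loop is distinguished.
\<close>

definition potential :: "('v \<Rightarrow> 'v \<Rightarrow> 'a) \<Rightarrow> 'v pair_pre_digraph \<Rightarrow> ('v \<Rightarrow> 'a) \<Rightarrow> bool" where
  "potential F D \<phi> \<longleftrightarrow>
     (\<forall>z. \<phi> z \<in> carrier G) \<and> (\<forall>(x, y) \<in> parcs D. F x y = inv (\<phi> x) \<otimes> \<phi> y)"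

lemma walk_product_potential:
  assumes "potential F D \<phi>" "\<And>a. F a a = \<one>"
    and "\<And>i. i < n \<Longrightarrow> s i = s (Suc i) \<or> (s i, s (Suc i)) \<in> parcs D"
  shows "walk_product G F s n = inv (\<phi> (s 0)) \<otimes> \<phi> (s n)"
  using assms(3)
proof (induction n)
  case 0
  then show ?case using assms(1) by (simp add: potential_def)
next
  case (Suc n)
  have c [simp]: "\<phi> z \<in> carrier G" for z using assms(1) by (simp add: potential_def)
  have "F (s n) (s (Suc n)) = inv (\<phi> (s n)) \<otimes> \<phi> (s (Suc n))"
    using Suc.prems[of n] assms(1,2) by (auto simp: potential_def)
  moreover have "\<phi> (s n) \<otimes> (inv (\<phi> (s n)) \<otimes> \<phi> (s (Suc n))) = \<phi> (s (Suc n))"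
    by (simp flip: m_assoc)
  ultimately show ?case using Suc by (simp add: m_assoc)
qed

text \<open>
  On the intersection both potentials have the same coboundary, so \<open>z \<mapsto> \<phi>2 z \<otimes> inv (\<phi>1 z)\<close> is constant
  along its edges. If the intersection is connected, then left multiplication by that constant
  adjusts \<open>\<phi>1\<close> so as to agree with \<open>\<phi>2\<close> there. Connectedness is expressed by the assumption that such
  functions are constant.
\<close>

lemma potential_glue:
  assumes 1: "potential F L1 \<phi>1" and 2: "potential F L2 \<phi>2"
    and wf: "pair_wf_digraph L1" "pair_wf_digraph L2"
    and conn: "\<And>(h :: 'v \<Rightarrow> 'a) x y. (\<And>x y. (x, y) \<in> parcs (graph_inter L1 L2) \<Longrightarrow> h x = h y) \<Longrightarrow>
      x \<in> pverts (graph_inter L1 L2) \<Longrightarrow> y \<in> pverts (graph_inter L1 L2) \<Longrightarrow> h x = h y"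
  shows "\<exists>\<phi>. potential F (graph_union L1 L2) \<phi>"
proof -
  have c [simp]: "\<phi>1 z \<in> carrier G" "\<phi>2 z \<in> carrier G" for z
    using 1 2 by (auto simp: potential_def)
  define h where "h z = \<phi>2 z \<otimes> inv (\<phi>1 z)" for z
  have h: "h x = h y" if "(x, y) \<in> parcs (graph_inter L1 L2)" for x y
  proof -
    have eq: "inv (\<phi>1 x) \<otimes> \<phi>1 y = inv (\<phi>2 x) \<otimes> \<phi>2 y"
      using that 1 2 by (fastforce simp: potential_def graph_inter_def)
    have "h x = \<phi>2 x \<otimes> (inv (\<phi>1 x) \<otimes> \<phi>1 y) \<otimes> inv (\<phi>1 y)"
      by (simp add: h_def m_assoc)
    also have "\<dots> = h y" unfolding eq by (simp add: h_def flip: m_assoc)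
    finally show ?thesis .
  qed
  obtain k where k: "k \<in> carrier G" "\<And>z. z \<in> pverts (graph_inter L1 L2) \<Longrightarrow> h z = k"
  proof (cases "pverts (graph_inter L1 L2) = {}")
    case True
    then show ?thesis using that[of \<one>] by auto
  next
    case False
    then obtain z where "z \<in> pverts (graph_inter L1 L2)" by auto
    then have "h z' = h z" if "z' \<in> pverts (graph_inter L1 L2)" for z'
      using conn[of h z' z] h that by blast
    then show ?thesis using that[of "h z"] by (simp add: h_def)
  qed
  define \<phi> where "\<phi> z = (if z \<in> pverts L1 then k \<otimes> \<phi>1 z else \<phi>2 z)" for z
  have \<phi>2: "\<phi> z = \<phi>2 z" if "z \<in> pverts L2" for z
  proof (cases "z \<in> pverts L1")
    case True
    then have "k = h z" using that k(2) by (simp add: graph_inter_def)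
    then show ?thesis using True by (simp add: \<phi>_def h_def m_assoc)
  qed (simp add: \<phi>_def)
  have "F x y = inv (\<phi> x) \<otimes> \<phi> y" if xy: "(x, y) \<in> parcs L1" for x y
  proof -
    have "x \<in> pverts L1" "y \<in> pverts L1"
      using xy pair_wf_digraph.arc_fst_in_verts[OF wf(1)] pair_wf_digraph.arc_snd_in_verts[OF wf(1)]
      by fastforce+
    then have "inv (\<phi> x) \<otimes> \<phi> y = inv (\<phi>1 x) \<otimes> (inv k \<otimes> (k \<otimes> \<phi>1 y))"
      using k(1) by (simp add: \<phi>_def inv_mult_group m_assoc)
    also have "\<dots> = inv (\<phi>1 x) \<otimes> \<phi>1 y" using k(1) by (simp flip: m_assoc)
    finally show ?thesis using xy 1 by (auto simp: potential_def)
  qed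
  moreover have "F x y = inv (\<phi> x) \<otimes> \<phi> y" if xy: "(x, y) \<in> parcs L2" for x y
  proof -
    have "x \<in> pverts L2" "y \<in> pverts L2"
      using xy pair_wf_digraph.arc_fst_in_verts[OF wf(2)] pair_wf_digraph.arc_snd_in_verts[OF wf(2)]
      by fastforce+
    then show ?thesis using xy 2 \<phi>2 by (auto simp: potential_def)
  qed
  ultimately have "potential F (graph_union L1 L2) \<phi>"
    using k(1) by (auto simp: potential_def graph_union_def \<phi>_def)
  then show ?thesis by blast
qed

text \<open>
  The image of a subpath is connected: consecutive vertices of the subpath are equal or joined by an
  edge, in one direction or the other.
\<close>

lemma subpath_constant:
  fixes h :: "'v \<Rightarrow> 'a"
  assumes "subpath_of U L A" and h: "\<And>x y. (x, y) \<in> parcs A \<Longrightarrow> h x = h y"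
    and "x \<in> pverts A" "y \<in> pverts A"
  shows "h x = h y"
proof -
  obtain n I f k l where I: "I \<in> path_graphs n" and kl: "k \<le> l" "l \<le> n"
      and A: "A = graph_image f (induced_on I {k..l})"
    using assms(1) by (auto simp: subpath_of_def reduced_loop_def reduced_path_def)
  have step: "h (f i) = h (f (Suc i))" if "k \<le> i" "Suc i \<le> l" for i
  proof (cases "f i = f (Suc i)")
    case False
    have "(i, Suc i) \<in> parcs (induced_on I {k..l}) \<or> (Suc i, i) \<in> parcs (induced_on I {k..l})"
      using I that kl by (auto simp: path_graphs_def induced_on_def)
    then have "(f i, f (Suc i)) \<in> parcs A \<or> (f (Suc i), f i) \<in> parcs A"
      using False graph_image_arc[of _ _ "induced_on I {k..l}" f] unfolding A by metis
    then show ?thesis using h by metis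
  qed simp
  have "i \<le> l \<Longrightarrow> h (f k) = h (f i)" if "k \<le> i" for i
    using that by (induction i rule: dec_induct) (auto simp: step)
  then have "h z = h (f k)" if "z \<in> pverts A" for z
    using that unfolding A graph_image_def induced_on_def by auto
  then show ?thesis using assms(3,4) by simp
qed

text \<open>
  The loop \<open>L\<close> is a subgraph of \<open>L1 \<union> L2\<close>, so it suffices to glue potentials along the path
  \<open>L1 \<inter> L2\<close>.
\<close>

lemma subdivides_potential:
  assumes "subdivides U L L1 L2" "\<exists>\<phi>. potential F L1 \<phi>" "\<exists>\<phi>. potential F L2 \<phi>"
  shows "\<exists>\<phi>. potential F L \<phi>"
proof -
  have wf: "pair_wf_digraph L1" "pair_wf_digraph L2"
    using assms(1) by (auto simp: subdivides_def loop_subgraph_def is_subgraph_def subgraph_def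
        wf_digraph_wp_iff)
  have sub: "subpath_of U L1 (graph_inter L1 L2)" and L: "parcs L \<subseteq> parcs (graph_union L1 L2)"
    using assms(1) by (auto simp: subdivides_def graph_minus_def)
  obtain \<phi>1 \<phi>2 where "potential F L1 \<phi>1" "potential F L2 \<phi>2" using assms(2,3) by auto
  then obtain \<phi> where "potential F (graph_union L1 L2) \<phi>"
    using potential_glue[OF _ _ wf subpath_constant[OF sub]] by metis
  then have "potential F L \<phi>" using L by (auto simp: potential_def)
  then show ?thesis by blast
qed

lemma subdivision_potential:
  assumes "subdivision U L Ls" "\<And>M. M \<in> set Ls \<Longrightarrow> \<exists>\<phi>. potential F M \<phi>"
  shows "\<exists>\<phi>. potential F L \<phi>"
  using assms
proof (induction rule: subdivision.induct)
  case (step L As M Bs L1 L2)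
  have "\<exists>\<phi>. potential F M \<phi>"
    using subdivides_potential[OF step.hyps(2)] step.prems by simp
  then show ?case using step.IH step.prems by auto
qed simp

end

text \<open>
  While a walk has length at most \<open>r\<close>, its starting point, its current point and its next point
  span a 2-simplex, so the product telescopes.
\<close>

lemma (in edge_cocycle) walk_product_cocycle:
  assumes K: "K = nerve r Z" and Z: "pair_wf_digraph Z"
    and "lazy_walk Z s n" "enat n \<le> r"
  shows "walk_product T c s n = c (s 0) (s n)"
  using assms(3,4)
proof (induction n)
  case 0
  then have "[s 0] \<in> K 0" unfolding K vertex_in_nerve by (simp add: lazy_walk_def)
  then show ?case by simp
next
  case (Suc n)
  interpret Z: pair_wf_digraph Z by fact
  have w: "lazy_walk Z s n" using Suc.prems by (simp add: lazy_walk_def)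
  have v: "s 0 \<in> pverts Z" "s n \<in> pverts Z" "s (Suc n) \<in> pverts Z"
    using Z.lazy_walk_in_verts[OF Suc.prems(1)] by auto
  have "path_dist Z (s n) (s (Suc n)) \<le> enat 1"
    using Suc.prems v by (intro Z.path_dist_step) (auto simp: lazy_walk_def)
  moreover have "enat (n + 1) \<le> r" using Suc.prems(2) by (simp only: Suc_eq_plus1)
  ultimately have "[s 0, s n, s (Suc n)] \<in> K 2"
    unfolding K triangle_in_nerve using v Z.path_dist_lazy_walk[OF w] by blast
  then have "c (s 0) (s n) \<otimes> c (s n) (s (Suc n)) = c (s 0) (s (Suc n))"
    by (rule cocycle)
  moreover have "enat n \<le> r" using Suc.prems(2) by (meson Suc_ile_eq less_imp_le)
  ultimately show ?case using Suc.IH[OF w] by simp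
qed

text \<open>
  Let \<open>a\<close> be the common starting point of the two branches. Every vertex \<open>z\<close> of \<open>D\<close> is reached from
  \<open>a\<close> by an initial piece of a branch, so \<open>(a, z)\<close> is a 1-simplex and \<open>P a z\<close> is a candidate for the
  potential at \<open>z\<close>; for an edge \<open>(x, y)\<close> of a branch, \<open>(a, x, y)\<close> is a 2-simplex. The
  branches may cross each other and repeat vertices arbitrarily.
\<close>

lemma degenerate_Gamma_potential:
  assumes P: "edge_cocycle (nerve r X) T P" and X: "pair_wf_digraph X" and s: "enat s \<le> r"
    and D: "degenerate_Gamma s U D" "pverts D \<subseteq> pverts X" "parcs D \<subseteq> parcs X"
    and F: "\<And>x y. (x, y) \<in> parcs X \<Longrightarrow> F x y = P x y"
  shows "\<exists>\<phi>. group.potential T F D \<phi>"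
proof -
  interpret X: pair_wf_digraph X by fact
  interpret P: edge_cocycle "nerve r X" T P by fact
  obtain g where g: "D = graph_image g (Gamma s)" using D(1) by (auto simp: degenerate_Gamma_def)
  define branch where "branch b i = g (if b then Gamma_u s i else Gamma_v s i)" for b i
  define a where "a = g (Gamma_u s 0)"
  have start: "branch b 0 = a" for b
    by (simp add: branch_def a_def Gamma_u_def Gamma_v_def)
  have "branch b i = branch b (Suc i) \<or> (branch b i, branch b (Suc i)) \<in> parcs X"
    if "i < s" for b i
  proof -
    let ?e = "\<lambda>j. if b then Gamma_u s j else Gamma_v s j"
    have "(?e i, ?e (Suc i)) \<in> parcs (Gamma s)" using that by (auto simp: Gamma_def)
    then have "g (?e i) = g (?e (Suc i)) \<or> (g (?e i), g (?e (Suc i))) \<in> parcs D"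
      unfolding g by (rule graph_image_arc)
    then show ?thesis using D(3) by (auto simp: branch_def)
  qed
  moreover have "a \<in> pverts X"
    using D(2) by (auto simp: g graph_image_def a_def Gamma_def)
  ultimately have walk: "lazy_walk X (branch b) s" for b
    by (simp add: lazy_walk_def start)
  have "F x y = inv\<^bsub>T\<^esub> (P a x) \<otimes>\<^bsub>T\<^esub> P a y" if xy: "(x, y) \<in> parcs D" for x y
  proof -
    obtain v w where "(v, w) \<in> parcs (Gamma s)" "x = g v" "y = g w"
      using xy by (auto simp: g graph_image_def)
    then obtain i where "i < s" "x = branch True i \<and> y = branch True (Suc i)
        \<or> x = branch False i \<and> y = branch False (Suc i)"
      by (auto simp: Gamma_def branch_def)
    then obtain b where i: "i < s" "x = branch b i" "y = branch b (Suc i)" by blast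
    have "lazy_walk X (branch b) i" using walk[of b] i(1) by (simp add: lazy_walk_def)
    then have 1: "path_dist X a x \<le> enat i"
      using X.path_dist_lazy_walk start i(2) by metis
    have 2: "path_dist X x y \<le> enat 1" "x \<in> pverts X" "y \<in> pverts X"
      using xy D(3) X.arc_fst_in_verts[of "(x, y)"] X.arc_snd_in_verts[of "(x, y)"]
      by (auto intro: X.path_dist_step)
    have "enat (i + 1) \<le> r" using i(1) s by (metis Suc_eq_plus1 Suc_leI enat_ord_simps(1) order_trans)
    moreover have "a \<in> pverts X" by fact
    ultimately have "P a x \<otimes>\<^bsub>T\<^esub> P x y = P a y"
      using 1 2 by (intro P.cocycle) (auto simp: triangle_in_nerve)
    then have "inv\<^bsub>T\<^esub> (P a x) \<otimes>\<^bsub>T\<^esub> P a y = P x y"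
      by (metis P.closed P.inv_solve_left)
    then show ?thesis using F xy D(3) by auto
  qed
  then show ?thesis by (intro exI[of _ "P a"]) (auto simp: P.potential_def)
qed

section \<open>Gluing cocycles over a separable pair\<close>

lemma graph_union_simps [simp]:
  "pverts (graph_union X Y) = pverts X \<union> pverts Y"
  "parcs (graph_union X Y) = parcs X \<union> parcs Y"
  by (simp_all add: graph_union_def)

lemma graph_inter_simps [simp]:
  "pverts (graph_inter X Y) = pverts X \<inter> pverts Y"
  "parcs (graph_inter X Y) = parcs X \<inter> parcs Y"
  by (simp_all add: graph_inter_def)

lemma pair_wf_digraph_union:
  "pair_wf_digraph X \<Longrightarrow> pair_wf_digraph Y \<Longrightarrow> pair_wf_digraph (graph_union X Y)"
  by (auto simp: pair_wf_digraph_def)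

lemma pair_wf_digraph_inter:
  "pair_wf_digraph X \<Longrightarrow> pair_wf_digraph Y \<Longrightarrow> pair_wf_digraph (graph_inter X Y)"
  by (auto simp: pair_wf_digraph_def)

text \<open>
  Two walks of length \<open>n\<close> with common ends are the branches of a degenerate \<open>\<Gamma>\<^sub>n\<close>. A potential on it
  computes both products from the values at the two ends.
\<close>

lemma (in group) walk_product_eq_if_Gamma_potential:
  assumes U: "pair_wf_digraph U" and F: "\<And>a. F a a = \<one>"
    and pot: "\<And>D. degenerate_Gamma n U D \<Longrightarrow> \<exists>\<phi>. potential F D \<phi>"
    and s: "lazy_walk U s n" and t: "lazy_walk U t n" and ends: "s 0 = t 0" "s n = t n"
  shows "walk_product G F s n = walk_product G F t n"
proof -
  interpret U: pair_wf_digraph U by fact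
  \<comment> \<open>The ends of the second branch are encoded as ends of the first, so they get their values from \<open>s\<close>.\<close>
  define f where "f v = (if fst v then s (snd v) else t (snd v))" for v
  have u: "f (Gamma_u n i) = s i" and v: "i \<le> n \<Longrightarrow> f (Gamma_v n i) = t i" for i
    using ends by (auto simp: f_def Gamma_u_def Gamma_v_def)
  have arc: "(s i, s (Suc i)) \<in> parcs U \<or> s i = s (Suc i)"
    "(t i, t (Suc i)) \<in> parcs U \<or> t i = t (Suc i)" if "i < n" for i
    using s t that by (auto simp: lazy_walk_def)
  have "graph_map (Gamma n) U f"
    unfolding graph_map_def
  proof (intro conjI ballI)
    fix x assume "x \<in> pverts (Gamma n)"
    then obtain i where "i \<le> n" "f x = s i \<or> f x = t i" using u v by (auto simp: Gamma_def)
    then show "f x \<in> pverts U" using U.lazy_walk_in_verts s t by metis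
  next
    fix e assume "e \<in> parcs (Gamma n)"
    then obtain i where "i < n"
      "e = (Gamma_u n i, Gamma_u n (Suc i)) \<or> e = (Gamma_v n i, Gamma_v n (Suc i))"
      by (auto simp: Gamma_def)
    then show "case e of (x, y) \<Rightarrow> (f x, f y) \<in> parcs U \<or> f x = f y"
      using arc[of i] u v by auto
  qed
  then obtain \<phi> where \<phi>: "potential F (graph_image f (Gamma n)) \<phi>"
    using pot by (auto simp: degenerate_Gamma_def)
  have "(Gamma_u n i, Gamma_u n (Suc i)) \<in> parcs (Gamma n)"
    "(Gamma_v n i, Gamma_v n (Suc i)) \<in> parcs (Gamma n)" if "i < n" for i
    using that by (auto simp: Gamma_def)
  from this[THEN graph_image_arc[where f = f]]
  have "s i = s (Suc i) \<or> (s i, s (Suc i)) \<in> parcs (graph_image f (Gamma n))"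
    "t i = t (Suc i) \<or> (t i, t (Suc i)) \<in> parcs (graph_image f (Gamma n))" if "i < n" for i
    using that u v by simp_all
  then show ?thesis
    using walk_product_potential[OF \<phi> F] ends by metis
qed

text \<open>
  The cocycles need to agree only on the edges that the two graphs share; this determines a value on
  each edge of the union.
\<close>

locale agreeing_cocycles =
  X: pair_wf_digraph X + Y: pair_wf_digraph Y +
  P: edge_cocycle "nerve r X" T P + Q: edge_cocycle "nerve r Y" T Q
  for r :: enat and X Y :: "'a pair_pre_digraph" and T :: "('t, 'm) monoid_scheme" (structure)
    and P Q +
  assumes sep: "separable r X Y"
    and agree: "(a, b) \<in> parcs X \<Longrightarrow> (a, b) \<in> parcs Y \<Longrightarrow> P a b = Q a b"
begin

abbreviation U where "U \<equiv> graph_union X Y"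

sublocale U: pair_wf_digraph U
  by (intro pair_wf_digraph_union X.pair_wf_digraph_axioms Y.pair_wf_digraph_axioms)

definition arc_value :: "'a \<Rightarrow> 'a \<Rightarrow> 't" where
  "arc_value a b = (if (a, b) \<in> parcs X then P a b else if (a, b) \<in> parcs Y then Q a b else \<one>)"

lemma arc_value_closed [simp]: "arc_value a b \<in> carrier T"
  by (simp add: arc_value_def)

lemma arc_value_unit [simp]: "arc_value a a = \<one>"
  using X.arc_fst_in_verts[of "(a, a)"] Y.arc_fst_in_verts[of "(a, a)"]
  by (auto simp: arc_value_def vertex_in_nerve)

lemma arc_value_X: "(a, b) \<in> parcs X \<Longrightarrow> arc_value a b = P a b"
  by (simp add: arc_value_def)

lemma arc_value_Y: "(a, b) \<in> parcs Y \<Longrightarrow> arc_value a b = Q a b"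
  using agree by (simp add: arc_value_def)

text \<open>
  Each piece lies in \<open>X\<close> or in \<open>Y\<close>, where the corresponding cocycle yields a potential. The bound
  \<open>n\<close> concerns the pieces, which for \<open>r = \<infinity>\<close> may be longer than the graph \<open>D\<close> they subdivide.
\<close>

lemma subdivided_within_potential:
  assumes "subdivided_within n X Y D" "enat n \<le> r"
  shows "\<exists>\<phi>. P.potential arc_value D \<phi>"
proof -
  obtain Ls where sub: "subdivision U D Ls" and Ls: "\<And>L. L \<in> set Ls \<Longrightarrow> degenerate_Gamma n U L \<and>
        (is_subgraph L X \<or> is_subgraph L Y)"
    using assms(1) by (auto simp: subdivided_within_def)
  show ?thesis
  proof (rule P.subdivision_potential[OF sub])
    fix L assume "L \<in> set Ls"
    then have L: "degenerate_Gamma n U L" "is_subgraph L X \<or> is_subgraph L Y" using Ls by auto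
    from L(2) show "\<exists>\<phi>. P.potential arc_value L \<phi>"
    proof
      assume "is_subgraph L X"
      then show ?thesis
        by (intro degenerate_Gamma_potential[OF P.edge_cocycle_axioms X.pair_wf_digraph_axioms assms(2) L(1)])
          (auto simp: is_subgraph_def subgraph_def arc_value_X)
    next
      assume "is_subgraph L Y"
      then show ?thesis
        by (intro degenerate_Gamma_potential[OF Q.edge_cocycle_axioms Y.pair_wf_digraph_axioms assms(2) L(1)])
          (auto simp: is_subgraph_def subgraph_def arc_value_Y)
    qed
  qed
qed

lemma Gamma_potential:
  assumes "enat n \<le> r"
  obtains N where "n \<le> N" "\<And>D. degenerate_Gamma N U D \<Longrightarrow> \<exists>\<phi>. P.potential arc_value D \<phi>"
proof (cases r)
  case (enat k)
  have "\<exists>\<phi>. P.potential arc_value D \<phi>" if "degenerate_Gamma k U D" for D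
    using sep that enat by (intro subdivided_within_potential[of k]) (auto simp: separable_def)
  then show ?thesis using that[of k] assms enat by simp
next
  case infinity
  \<comment> \<open>Separability at \<open>\<infinity>\<close> says nothing about \<open>\<Gamma>\<^sub>0\<close>.\<close>
  have "\<exists>\<phi>. P.potential arc_value D \<phi>" if D: "degenerate_Gamma (max 1 n) U D" for D
  proof -
    have "\<forall>N\<ge>1. \<forall>D. degenerate_Gamma N U D \<longrightarrow> (\<exists>s\<ge>N. subdivided_within s X Y D)"
      using sep infinity by (simp add: separable_def)
    then obtain s where "subdivided_within s X Y D" using D max.cobounded1 by blast
    then show ?thesis using infinity by (intro subdivided_within_potential) auto
  qed
  then show ?thesis using that[of "max 1 n"] by simp
qed

text \<open>
  Pausing at the end prolongs both walks to a common length at which separability applies.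
\<close>

lemma walk_product_eq:
  assumes s: "lazy_walk U s n" "enat n \<le> r" and t: "lazy_walk U t m" "enat m \<le> r"
    and ends: "s 0 = t 0" "s n = t m"
  shows "walk_product T arc_value s n = walk_product T arc_value t m"
proof -
  have "enat (max n m) \<le> r" using s(2) t(2) by (simp add: max_def)
  then obtain N where N: "max n m \<le> N" "\<And>D. degenerate_Gamma N U D \<Longrightarrow> \<exists>\<phi>. P.potential arc_value D \<phi>"
    using Gamma_potential by blast
  have "walk_product T arc_value (\<lambda>i. s (min i n)) N = walk_product T arc_value (\<lambda>i. t (min i m)) N"
    using N lazy_walk_pad[OF s(1), of N] lazy_walk_pad[OF t(1), of N] ends
    by (intro P.walk_product_eq_if_Gamma_potential[OF U.pair_wf_digraph_axioms]) (auto simp: min_def)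
  then show ?thesis using N(1) by (simp add: P.walk_product_pad)
qed

text \<open>
  A product along some walk of admissible length; all of them agree on the 1-simplices of the union.
\<close>

definition glued :: "'a \<Rightarrow> 'a \<Rightarrow> 't" where
  "glued a b = (case SOME (s, n). lazy_walk U s n \<and> enat n \<le> r \<and> s 0 = a \<and> s n = b
     of (s, n) \<Rightarrow> walk_product T arc_value s n)"

lemma glued_eq_walk_product:
  assumes "lazy_walk U s n" "enat n \<le> r"
  shows "glued (s 0) (s n) = walk_product T arc_value s n"
proof -
  define W where "W = (\<lambda>(t, m). lazy_walk U t m \<and> enat m \<le> r \<and> t 0 = s 0 \<and> t m = s n)"
  have "W (s, n)" using assms by (simp add: W_def)
  then have "W (Eps W)" by (rule someI)
  then obtain t m where tm: "Eps W = (t, m)" "W (t, m)" by (metis surj_pair)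
  then have "walk_product T arc_value t m = walk_product T arc_value s n"
    using assms by (intro walk_product_eq) (auto simp: W_def)
  then show ?thesis using tm(1) by (simp add: glued_def W_def)
qed

lemma edge_walk:
  assumes "pair_wf_digraph Z" "[a, b] \<in> nerve r Z 1"
  obtains s n where "lazy_walk Z s n" "enat n \<le> r" "s 0 = a" "s n = b"
  using assms pair_wf_digraph.path_dist_le_iff[OF assms(1)] by (auto simp: edge_in_nerve)

text \<open>
  The cocycle condition holds because two walks that witness a 2-simplex can be concatenated within
  the bound \<open>r\<close>.
\<close>

lemma edge_cocycle_glued: "edge_cocycle (nerve r U) T glued"
proof (intro edge_cocycle.intro edge_cocycle_axioms.intro)
  show "edge_complex (nerve r U)" by (rule U.edge_complex_nerve)
  show "group T" by (rule P.is_group)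
next
  fix a b
  show "glued a b \<in> carrier T"
    by (simp add: glued_def P.walk_product_closed split: prod.split)
next
  fix a assume "[a] \<in> nerve r U 0"
  then show "glued a a = \<one>"
    using glued_eq_walk_product[of "\<lambda>_. a" 0]
    by (simp add: vertex_in_nerve lazy_walk_def flip: zero_enat_def)
next
  fix a b d assume "[a, b, d] \<in> nerve r U 2"
  then obtain n m where nm: "enat (n + m) \<le> r" "path_dist U a b \<le> enat n" "path_dist U b d \<le> enat m"
    by (auto simp: triangle_in_nerve)
  then obtain s t where s: "lazy_walk U s n" "s 0 = a" "s n = b" and t: "lazy_walk U t m" "t 0 = b" "t m = d"
    unfolding U.path_dist_le_iff by auto
  have st: "s n = t 0" using s t by simp
  have le: "enat n \<le> r" "enat m \<le> r"
    using nm(1) by (meson enat_ord_simps(1) le_add1 le_add2 order_trans)+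
  have "glued a d = walk_product T arc_value (walk_append n s t) (n + m)"
    using glued_eq_walk_product[OF lazy_walk_append[OF s(1) t(1) st] nm(1)]
      walk_append_ends[where s = s and t = t and n = n and m = m, OF st] s t by simp
  also have "\<dots> = walk_product T arc_value s n \<otimes> walk_product T arc_value t m"
    by (rule P.walk_product_append[where s = s and t = t, OF _ st]) simp
  also have "\<dots> = glued a b \<otimes> glued b d"
    using glued_eq_walk_product[OF s(1) le(1)] glued_eq_walk_product[OF t(1) le(2)] s t by simp
  finally show "glued a b \<otimes> glued b d = glued a d" by simp
qed

text \<open>
  A cocycle is determined by its values on edges, as its value on a 1-simplex is a product along a walk.
  With \<open>Z\<close> equal to \<open>X\<close> or \<open>Y\<close> this says that the glued cocycle extends the given ones, and with
  \<open>Z\<close> equal to the union it gives uniqueness.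
\<close>

lemma glued_unique:
  assumes c: "edge_cocycle (nerve r Z) T c" and Z: "pair_wf_digraph Z"
    and sub: "pverts Z \<subseteq> pverts U" "parcs Z \<subseteq> parcs U"
    and Z_arcs: "\<And>a b. (a, b) \<in> parcs Z \<Longrightarrow> c a b = arc_value a b"
    and ab: "[a, b] \<in> nerve r Z 1"
  shows "glued a b = c a b"
proof -
  interpret c: edge_cocycle "nerve r Z" T c by fact
  obtain s n where s: "lazy_walk Z s n" "enat n \<le> r" "s 0 = a" "s n = b"
    using edge_walk[OF Z ab] .
  have "lazy_walk U s n" using s(1) sub by (auto simp: lazy_walk_def)
  then have "glued a b = walk_product T arc_value s n" using glued_eq_walk_product s by blast
  also have "\<dots> = walk_product T c s n"
  proof (rule walk_product_cong)
    fix i assume i: "i < n"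
    then have "s i \<in> pverts Z" using pair_wf_digraph.lazy_walk_in_verts[OF Z s(1)] by simp
    then show "arc_value (s i) (s (Suc i)) = c (s i) (s (Suc i))"
      using s(1) i Z_arcs by (cases "s i = s (Suc i)") (auto simp: lazy_walk_def vertex_in_nerve)
  qed
  also have "\<dots> = c a b"
    using c.walk_product_cocycle[OF _ Z s(1,2)] s(3,4) by simp
  finally show ?thesis .
qed

lemma glued_X: "[a, b] \<in> nerve r X 1 \<Longrightarrow> glued a b = P a b"
  by (rule glued_unique[OF P.edge_cocycle_axioms X.pair_wf_digraph_axioms]) (auto simp: arc_value_X)

lemma glued_Y: "[a, b] \<in> nerve r Y 1 \<Longrightarrow> glued a b = Q a b"
  by (rule glued_unique[OF Q.edge_cocycle_axioms Y.pair_wf_digraph_axioms]) (auto simp: arc_value_Y)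

end

section \<open>The pushout property\<close>

lemma connected_edge_word:
  assumes A: "pair_wf_digraph A" and conn: "connected (with_proj A)" and r: "1 \<le> r"
    and x: "x \<in> pverts A" and z: "z \<in> pverts A"
  shows "\<exists>w. edge_word (nerve r A) x w z"
proof -
  interpret A: pair_wf_digraph A by fact
  have "x \<rightarrow>\<^sup>*\<^bsub>with_proj (mk_symmetric (with_proj A))\<^esub> z"
    using conn x z unfolding connected_def strongly_connected_def by simp
  then have "(x, z) \<in> rtrancl_on (pverts A) (parcs (mk_symmetric (with_proj A)))"
    by (simp add: reachable_def)
  then show ?thesis
  proof (induction rule: rtrancl_on_induct)
    case base
    then show ?case using x by (intro exI[of _ "[]"]) (simp add: vertex_in_nerve)
  next
    case (step y z)
    then obtain w where w: "edge_word (nerve r A) x w y" by auto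
    have "(y, z) \<in> parcs A \<or> (z, y) \<in> parcs A"
      using step by (auto simp: parcs_mk_symmetric)
    then have "\<exists>l. edge_word (nerve r A) y [l] z"
    proof
      assume "(y, z) \<in> parcs A"
      then show ?thesis using step r A.arc_in_nerve
        by (intro exI[of _ "Fwd y z"]) (auto simp: vertex_in_nerve)
    next
      assume "(z, y) \<in> parcs A"
      then show ?thesis using step r A.arc_in_nerve
        by (intro exI[of _ "Bwd z y"]) (auto simp: vertex_in_nerve)
    qed
    then show ?case using edge_word_append[OF w] by blast
  qed
qed

lemma induced_hom_inclusion: "induced_hom r Z (\<lambda>x. x) x0 = class_inclusion (nerve r Z) x0"
proof -
  have "map_letter (\<lambda>x. x) = (\<lambda>l :: 'a letter. l)" by (rule ext) (simp add: letter.map_ident)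
  then have "map (map_letter (\<lambda>x. x)) v = v" for v :: "'a letter list" by simp
  then show ?thesis by (intro ext) (simp only: induced_hom_def class_inclusion_def)
qed

lemma fundamental_group_edge_group: "fundamental_group r Z x0 = edge_group (nerve r Z) x0"
  by (simp add: fundamental_group_def edge_group_def)

text \<open>
  A common choice of words joining \<open>x0\<close> to the vertices of its component, such that the word to a
  vertex of \<open>X\<close> runs in \<open>X\<close> and the word to a vertex of \<open>Y\<close> runs in \<open>Y\<close>.
\<close>

locale connected_intersection =
  X: pair_wf_digraph X + Y: pair_wf_digraph Y
  for X Y :: "'a pair_pre_digraph" +
  fixes r :: enat and x0 :: 'a
  assumes r: "1 \<le> r" and x0: "x0 \<in> pverts X" "x0 \<in> pverts Y"
    and conn: "connected (with_proj (graph_inter X Y))"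
begin

abbreviation A where "A \<equiv> graph_inter X Y"
abbreviation U where "U \<equiv> graph_union X Y"

sublocale A: pair_wf_digraph A
  by (intro pair_wf_digraph_inter X.pair_wf_digraph_axioms Y.pair_wf_digraph_axioms)
sublocale U: pair_wf_digraph U
  by (intro pair_wf_digraph_union X.pair_wf_digraph_axioms Y.pair_wf_digraph_axioms)

sublocale NX: edge_complex "nerve r X" by (rule X.edge_complex_nerve)
sublocale NY: edge_complex "nerve r Y" by (rule Y.edge_complex_nerve)
sublocale NA: edge_complex "nerve r A" by (rule A.edge_complex_nerve)
sublocale NU: edge_complex "nerve r U" by (rule U.edge_complex_nerve)

lemma nerve_inclusions:
  "nerve r A \<le> nerve r X" "nerve r A \<le> nerve r Y"
  "nerve r X \<le> nerve r U" "nerve r Y \<le> nerve r U"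
  by (rule nerve_mono; simp)+

text \<open>
  This turns out to be the component of \<open>x0\<close> in the union: a path that passes from one graph to the
  other does so at a vertex of the intersection, and such a vertex is joined to \<open>x0\<close> in both graphs.
\<close>

definition base_component :: "'a set" where
  "base_component =
     {z. (\<exists>w. edge_word (nerve r X) x0 w z) \<or> (\<exists>w. edge_word (nerve r Y) x0 w z)}"

text \<open>
  Words in the intersection take precedence, since they belong to both \<open>X\<close> and \<open>Y\<close>; this is what makes
  the cocycles of compatible homomorphisms agree on common edges.
\<close>

definition transport_word :: "'a \<Rightarrow> 'a letter list" where
  "transport_word z =
     (if z = x0 then []
      else if \<exists>w. edge_word (nerve r A) x0 w z then SOME w. edge_word (nerve r A) x0 w z
      else if \<exists>w. edge_word (nerve r X) x0 w z then SOME w. edge_word (nerve r X) x0 w z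
      else SOME w. edge_word (nerve r Y) x0 w z)"

lemma transport_A:
  assumes "z \<in> pverts A"
  shows "edge_word (nerve r A) x0 (transport_word z) z"
proof (cases "z = x0")
  case True
  then show ?thesis using x0 by (simp add: transport_word_def vertex_in_nerve)
next
  case False
  have ex: "\<exists>w. edge_word (nerve r A) x0 w z"
    by (rule connected_edge_word[OF A.pair_wf_digraph_axioms conn r _ assms]) (simp add: x0)
  then have "transport_word z = (SOME w. edge_word (nerve r A) x0 w z)"
    unfolding transport_word_def using False by (simp only: if_True if_False)
  then show ?thesis using someI_ex[OF ex] by (simp only:)
qed

lemma transport_X:
  assumes "z \<in> pverts X" "z \<in> base_component"
  shows "edge_word (nerve r X) x0 (transport_word z) z"
proof (cases "z \<in> pverts Y")
  case True
  then show ?thesis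
    using assms edge_word_mono[OF nerve_inclusions(1) transport_A] by simp
next
  case False
  then have no: "\<not> edge_word (nerve r A) x0 w z" "\<not> edge_word (nerve r Y) x0 w z" for w
    using NA.edge_word_ends[of x0 w z] NY.edge_word_ends[of x0 w z] by (auto simp: vertex_in_nerve)
  then have ex: "\<exists>w. edge_word (nerve r X) x0 w z"
    using assms(2) by (auto simp: base_component_def)
  have "transport_word z = (SOME w. edge_word (nerve r X) x0 w z)"
    using no ex x0 False unfolding transport_word_def by metis
  then show ?thesis using someI_ex[OF ex] by (simp only:)
qed

lemma transport_Y:
  assumes "z \<in> pverts Y" "z \<in> base_component"
  shows "edge_word (nerve r Y) x0 (transport_word z) z"
proof (cases "z \<in> pverts X")
  case True
  then show ?thesis
    using assms edge_word_mono[OF nerve_inclusions(2) transport_A] by simp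
next
  case False
  then have no: "\<not> edge_word (nerve r A) x0 w z" "\<not> edge_word (nerve r X) x0 w z" for w
    using NA.edge_word_ends[of x0 w z] NX.edge_word_ends[of x0 w z] by (auto simp: vertex_in_nerve)
  then have ex: "\<exists>w. edge_word (nerve r Y) x0 w z"
    using assms(2) by (auto simp: base_component_def)
  have "transport_word z = (SOME w. edge_word (nerve r Y) x0 w z)"
    using no ex x0 False unfolding transport_word_def by metis
  then show ?thesis using someI_ex[OF ex] by (simp only:)
qed

lemma intersection_in_component: "z \<in> pverts A \<Longrightarrow> z \<in> base_component"
  unfolding base_component_def using edge_word_mono[OF nerve_inclusions(1) transport_A] by blast

text \<open>
  A word to one end of an edge of \<open>X\<close> can be taken in \<open>X\<close>, where it extends along the edge, and
  likewise for \<open>Y\<close>.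
\<close>

lemma base_component_arc:
  assumes "(a, b) \<in> parcs U"
  shows "a \<in> base_component \<longleftrightarrow> b \<in> base_component"
proof -
  have X: "edge_word (nerve r X) a [Fwd a b] b \<and> edge_word (nerve r X) b [Bwd a b] a"
    if "(a, b) \<in> parcs X"
    using X.arc_in_nerve[OF r that] NX.face1 by auto
  have Y: "edge_word (nerve r Y) a [Fwd a b] b \<and> edge_word (nerve r Y) b [Bwd a b] a"
    if "(a, b) \<in> parcs Y"
    using Y.arc_in_nerve[OF r that] NY.face1 by auto
  have in_component: "edge_word (nerve r X) x0 w z \<Longrightarrow> z \<in> base_component"
    "edge_word (nerve r Y) x0 w z \<Longrightarrow> z \<in> base_component" for w z
    by (auto simp: base_component_def)
  from assms consider "(a, b) \<in> parcs X" | "(a, b) \<in> parcs Y" by auto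
  then show ?thesis
  proof cases
    case 1
    then have "a \<in> pverts X" "b \<in> pverts X"
      using X.arc_fst_in_verts[of "(a, b)"] X.arc_snd_in_verts[of "(a, b)"] by auto
    then show ?thesis
      using X[OF 1] transport_X edge_word_append[of "nerve r X" x0] in_component(1)
      by metis
  next
    case 2
    then have "a \<in> pverts Y" "b \<in> pverts Y"
      using Y.arc_fst_in_verts[of "(a, b)"] Y.arc_snd_in_verts[of "(a, b)"] by auto
    then show ?thesis
      using Y[OF 2] transport_Y edge_word_append[of "nerve r Y" x0] in_component(2)
      by metis
  qed
qed

lemma base_component_invariant:
  assumes "[a, b] \<in> nerve r U 1"
  shows "a \<in> base_component \<longleftrightarrow> b \<in> base_component"
proof -
  obtain s n where s: "lazy_walk U s n" "s 0 = a" "s n = b"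
    using assms by (auto simp: edge_in_nerve U.path_dist_le_iff)
  have "i \<le> n \<Longrightarrow> s 0 \<in> base_component \<longleftrightarrow> s i \<in> base_component" for i
  proof (induction i)
    case (Suc i)
    then have "s i = s (Suc i) \<or> (s i, s (Suc i)) \<in> parcs U" using s(1) by (simp add: lazy_walk_def)
    then show ?case using Suc base_component_arc by auto
  qed simp
  then show ?thesis using s by blast
qed

lemma x0_in_component: "x0 \<in> base_component"
  using intersection_in_component x0 by simp

sublocale BX: based_complex "nerve r X" x0 base_component transport_word
proof
  fix a b assume "[a, b] \<in> nerve r X 1"
  then show "a \<in> base_component \<longleftrightarrow> b \<in> base_component"
    using base_component_invariant nerve_inclusions(3) by (auto simp: le_fun_def)
qed (use x0 x0_in_component transport_X in \<open>auto simp: vertex_in_nerve transport_word_def\<close>)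

sublocale BY: based_complex "nerve r Y" x0 base_component transport_word
proof
  fix a b assume "[a, b] \<in> nerve r Y 1"
  then show "a \<in> base_component \<longleftrightarrow> b \<in> base_component"
    using base_component_invariant nerve_inclusions(4) by (auto simp: le_fun_def)
qed (use x0 x0_in_component transport_Y in \<open>auto simp: vertex_in_nerve transport_word_def\<close>)

sublocale BU: based_complex "nerve r U" x0 base_component transport_word
proof
  fix a assume a: "a \<in> base_component" "[a] \<in> nerve r U 0"
  then consider "a \<in> pverts X" | "a \<in> pverts Y" by (auto simp: vertex_in_nerve)
  then show "edge_word (nerve r U) x0 (transport_word a) a"
    using a transport_X transport_Y edge_word_mono[OF nerve_inclusions(3)]
      edge_word_mono[OF nerve_inclusions(4)] by cases blast+
qed (use x0 x0_in_component base_component_invariant in \<open>auto simp: vertex_in_nerve transport_word_def\<close>)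

lemma inclusion_of_word_classes:
  "edge_word (nerve r A) x0 w x0 \<Longrightarrow>
    class_inclusion (nerve r X) x0 (word_class (nerve r A) x0 x0 w) = word_class (nerve r X) x0 x0 w"
  "edge_word (nerve r A) x0 w x0 \<Longrightarrow>
    class_inclusion (nerve r Y) x0 (word_class (nerve r A) x0 x0 w) = word_class (nerve r Y) x0 x0 w"
  "edge_word (nerve r X) x0 w x0 \<Longrightarrow>
    class_inclusion (nerve r U) x0 (word_class (nerve r X) x0 x0 w) = word_class (nerve r U) x0 x0 w"
  "edge_word (nerve r Y) x0 w x0 \<Longrightarrow>
    class_inclusion (nerve r U) x0 (word_class (nerve r Y) x0 x0 w) = word_class (nerve r U) x0 x0 w"
  by (rule class_inclusion_word_class; (rule nerve_inclusions | assumption))+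

text \<open>
  Existence: the cocycles of \<open>p\<close> and \<open>q\<close> agree on common edges because the loops \<open>edge_loop a b\<close> there
  come from the intersection; their glued cocycle evaluates loops in the union. Uniqueness: any
  competing homomorphism has a cocycle of its own, whose values on edges are forced by \<open>p\<close> and \<open>q\<close>.
\<close>

lemma pushout_universal:
  fixes T :: "'t monoid"
  assumes sep: "separable r X Y" and T: "group T"
    and p: "p \<in> hom (edge_group (nerve r X) x0) T" and q: "q \<in> hom (edge_group (nerve r Y) x0) T"
    and pq: "\<And>a. a \<in> carrier (edge_group (nerve r A) x0) \<Longrightarrow>
       p (class_inclusion (nerve r X) x0 a) = q (class_inclusion (nerve r Y) x0 a)"
  shows "\<exists>!u. u \<in> hom (edge_group (nerve r U) x0) T
      \<and> u \<in> extensional (carrier (edge_group (nerve r U) x0))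
      \<and> (\<forall>b\<in>carrier (edge_group (nerve r X) x0). u (class_inclusion (nerve r U) x0 b) = p b)
      \<and> (\<forall>b\<in>carrier (edge_group (nerve r Y) x0). u (class_inclusion (nerve r U) x0 b) = q b)"
proof -
  define P where "P = BX.hom_cocycle T p"
  define Q where "Q = BY.hom_cocycle T q"
  have P: "edge_cocycle (nerve r X) T P" and Q: "edge_cocycle (nerve r Y) T Q"
    unfolding P_def Q_def by (rule BX.edge_cocycle_hom_cocycle BY.edge_cocycle_hom_cocycle T p q)+
  have agree: "P a b = Q a b" if "(a, b) \<in> parcs X" "(a, b) \<in> parcs Y" for a b
  proof -
    have ab: "(a, b) \<in> parcs A" using that by simp
    have v: "a \<in> pverts A" "b \<in> pverts A"
      using A.arc_fst_in_verts[OF ab] A.arc_snd_in_verts[OF ab] by auto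
    let ?w = "BX.edge_loop a b"
    have w: "edge_word (nerve r A) x0 ?w x0"
      unfolding BX.edge_loop_def using v A.arc_in_nerve[OF r ab]
      by (auto intro!: edge_word_append[OF transport_A] NA.edge_word_inverse transport_A)
    have "p (word_class (nerve r X) x0 x0 ?w) = q (word_class (nerve r Y) x0 x0 ?w)"
      using pq[of "word_class (nerve r A) x0 x0 ?w"] w
      by (auto simp: carrier_edge_group inclusion_of_word_classes)
    then show ?thesis
      using that intersection_in_component[OF v(1)] X.arc_in_nerve[OF r] Y.arc_in_nerve[OF r]
      by (simp add: P_def Q_def BX.hom_cocycle_def BY.hom_cocycle_def)
  qed
  interpret PQ: agreeing_cocycles r X Y T P Q
    by (intro agreeing_cocycles.intro agreeing_cocycles_axioms.intro
        X.pair_wf_digraph_axioms Y.pair_wf_digraph_axioms P Q sep agree)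
  interpret c: edge_cocycle "nerve r U" T PQ.glued by (rule PQ.edge_cocycle_glued)
  show ?thesis
  proof (rule ex1I[of _ "c.value_hom x0"], intro conjI ballI)
    show "c.value_hom x0 \<in> hom (edge_group (nerve r U) x0) T" by (rule c.value_hom)
    show "c.value_hom x0 \<in> extensional (carrier (edge_group (nerve r U) x0))"
      by (simp add: c.value_hom_def)
  next
    fix b assume "b \<in> carrier (edge_group (nerve r X) x0)"
    then obtain w where w: "edge_word (nerve r X) x0 w x0" "b = word_class (nerve r X) x0 x0 w"
      by (auto simp: carrier_edge_group)
    have "c.value_hom x0 (class_inclusion (nerve r U) x0 b) = word_value T PQ.glued w"
      using w edge_word_mono[OF nerve_inclusions(3) w(1)]
      by (simp add: inclusion_of_word_classes c.value_hom_word_class)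
    also have "\<dots> = word_value T P w"
      by (rule word_value_cong[OF PQ.glued_X w(1)])
    also have "\<dots> = p b" using BX.hom_eq_value[OF T p w(1)] w(2) by (simp add: P_def)
    finally show "c.value_hom x0 (class_inclusion (nerve r U) x0 b) = p b" .
  next
    fix b assume "b \<in> carrier (edge_group (nerve r Y) x0)"
    then obtain w where w: "edge_word (nerve r Y) x0 w x0" "b = word_class (nerve r Y) x0 x0 w"
      by (auto simp: carrier_edge_group)
    have "c.value_hom x0 (class_inclusion (nerve r U) x0 b) = word_value T PQ.glued w"
      using w edge_word_mono[OF nerve_inclusions(4) w(1)]
      by (simp add: inclusion_of_word_classes c.value_hom_word_class)
    also have "\<dots> = word_value T Q w"
      by (rule word_value_cong[OF PQ.glued_Y w(1)])
    also have "\<dots> = q b" using BY.hom_eq_value[OF T q w(1)] w(2) by (simp add: Q_def)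
    finally show "c.value_hom x0 (class_inclusion (nerve r U) x0 b) = q b" .
  next
    fix u assume u: "u \<in> hom (edge_group (nerve r U) x0) T
      \<and> u \<in> extensional (carrier (edge_group (nerve r U) x0))
      \<and> (\<forall>b\<in>carrier (edge_group (nerve r X) x0). u (class_inclusion (nerve r U) x0 b) = p b)
      \<and> (\<forall>b\<in>carrier (edge_group (nerve r Y) x0). u (class_inclusion (nerve r U) x0 b) = q b)"
    then have hom: "u \<in> hom (edge_group (nerve r U) x0) T" by simp
    let ?d = "BU.hom_cocycle T u"
    have dX: "?d a b = P a b" if "(a, b) \<in> parcs X" for a b
    proof (cases "a \<in> base_component")
      case True
      have s: "[a, b] \<in> nerve r X 1" "[a, b] \<in> nerve r U 1"
        using X.arc_in_nerve[OF r that] nerve_inclusions(3) by (auto simp: le_fun_def)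
      have w: "edge_word (nerve r X) x0 (BX.edge_loop a b) x0"
        by (rule BX.edge_word_edge_loop[OF s(1) True])
      then have "u (word_class (nerve r U) x0 x0 (BX.edge_loop a b))
          = p (word_class (nerve r X) x0 x0 (BX.edge_loop a b))"
        using u by (metis (no_types, lifting) carrier_edge_group image_eqI inclusion_of_word_classes(3)
            mem_Collect_eq)
      then show ?thesis
        using s True by (simp add: P_def BX.hom_cocycle_def BU.hom_cocycle_def)
    qed (simp add: P_def BX.hom_cocycle_def BU.hom_cocycle_def)
    have dY: "?d a b = Q a b" if "(a, b) \<in> parcs Y" for a b
    proof (cases "a \<in> base_component")
      case True
      have s: "[a, b] \<in> nerve r Y 1" "[a, b] \<in> nerve r U 1"
        using Y.arc_in_nerve[OF r that] nerve_inclusions(4) by (auto simp: le_fun_def)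
      have w: "edge_word (nerve r Y) x0 (BY.edge_loop a b) x0"
        by (rule BY.edge_word_edge_loop[OF s(1) True])
      then have "u (word_class (nerve r U) x0 x0 (BY.edge_loop a b))
          = q (word_class (nerve r Y) x0 x0 (BY.edge_loop a b))"
        using u by (metis (no_types, lifting) carrier_edge_group image_eqI inclusion_of_word_classes(4)
            mem_Collect_eq)
      then show ?thesis
        using s True by (simp add: Q_def BY.hom_cocycle_def BU.hom_cocycle_def)
    qed (simp add: Q_def BY.hom_cocycle_def BU.hom_cocycle_def)
    have "?d a b = PQ.arc_value a b" if "(a, b) \<in> parcs U" for a b
      using that dX dY PQ.arc_value_X PQ.arc_value_Y by auto
    then have d: "PQ.glued a b = ?d a b" if "[a, b] \<in> nerve r U 1" for a b
      using that by (intro PQ.glued_unique[OF BU.edge_cocycle_hom_cocycle[OF T hom]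
            U.pair_wf_digraph_axioms]) auto
    show "u = c.value_hom x0"
    proof (rule extensionalityI)
      fix a assume "a \<in> carrier (edge_group (nerve r U) x0)"
      then obtain w where w: "edge_word (nerve r U) x0 w x0" "a = word_class (nerve r U) x0 x0 w"
        by (auto simp: carrier_edge_group)
      have "u a = word_value T ?d w" using BU.hom_eq_value[OF T hom w(1)] w(2) by simp
      also have "\<dots> = word_value T PQ.glued w"
        by (rule word_value_cong[OF d w(1), symmetric])
      finally show "u a = c.value_hom x0 a" using w by (simp add: c.value_hom_word_class)
    qed (use u in \<open>auto simp: c.value_hom_def\<close>)
  qed
qed

end

theorem corollary5p12:
  fixes r :: enat and X Y :: "'a pair_pre_digraph" and x0 :: 'a
  assumes "1 \<le> r"
    and "pair_loopfree_digraph X" and "pair_loopfree_digraph Y"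
    and "x0 \<in> pverts X" and "x0 \<in> pverts Y"
    and "separable r X Y"
    and "connected (with_proj (graph_inter X Y))"
  shows "is_pushout TYPE('t)
    (fundamental_group r (graph_inter X Y) x0)
    (fundamental_group r X x0)
    (fundamental_group r Y x0)
    (fundamental_group r (graph_union X Y) x0)
    (induced_hom r X (\<lambda>x. x) x0)
    (induced_hom r Y (\<lambda>x. x) x0)
    (induced_hom r (graph_union X Y) (\<lambda>x. x) x0)
    (induced_hom r (graph_union X Y) (\<lambda>x. x) x0)"
proof -
  interpret XY: connected_intersection X Y r x0
    using assms by (intro connected_intersection.intro connected_intersection_axioms.intro)
      (auto simp: pair_loopfree_digraph_def)
  have "group (edge_group (nerve r XY.A) x0)" "group (edge_group (nerve r X) x0)"
    "group (edge_group (nerve r Y) x0)" "group (edge_group (nerve r XY.U) x0)"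
    using assms(4,5)
    by (auto intro!: XY.NA.group_edge_group XY.NX.group_edge_group XY.NY.group_edge_group
        XY.NU.group_edge_group simp: vertex_in_nerve)
  moreover have "class_inclusion (nerve r X) x0 \<in> hom (edge_group (nerve r XY.A) x0) (edge_group (nerve r X) x0)"
    "class_inclusion (nerve r Y) x0 \<in> hom (edge_group (nerve r XY.A) x0) (edge_group (nerve r Y) x0)"
    "class_inclusion (nerve r XY.U) x0 \<in> hom (edge_group (nerve r X) x0) (edge_group (nerve r XY.U) x0)"
    "class_inclusion (nerve r XY.U) x0 \<in> hom (edge_group (nerve r Y) x0) (edge_group (nerve r XY.U) x0)"
    by (rule class_inclusion_hom XY.nerve_inclusions XY.NA.edge_complex_axioms XY.NX.edge_complex_axioms
        XY.NY.edge_complex_axioms XY.NU.edge_complex_axioms)+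
  moreover have "class_inclusion (nerve r XY.U) x0 (class_inclusion (nerve r X) x0 a)
      = class_inclusion (nerve r XY.U) x0 (class_inclusion (nerve r Y) x0 a)"
    if "a \<in> carrier (edge_group (nerve r XY.A) x0)" for a
    using that edge_word_mono[OF XY.nerve_inclusions(1)] edge_word_mono[OF XY.nerve_inclusions(2)]
    by (auto simp: carrier_edge_group XY.inclusion_of_word_classes)
  ultimately show ?thesis
    unfolding is_pushout_def fundamental_group_edge_group induced_hom_inclusion
    using XY.pushout_universal[OF assms(6)] by blast
qed

end
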